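(* Let $\gamma>0$ and $\alpha\in(0,1]$. The algebra $\mathcal H^{\rm S}\mathcal I_{\gamma,\alpha}^{\rm s\omega}$ (with product $*_\gamma$) is commutative if and only if each function $f$ in this algebra is determined by its moments $\mu_{e,\gamma}(f)$ ($e\in\mathbf Z_{\ge0}$).
   Context: Fix $0<q<1$. $[e]_q=\frac{1-q^e}{1-q}$, $[e]_q!=[1]_q\cdots[e]_q$. The $q$-derivative is $(\partial f)(x)=\frac{f(x)-f(qx)}{(1-q)x}$ for $x\ne0$; for functions holomorphic near $0$ its value at $0$ is given by analytic continuation. For $\gamma>0$ let $L(\gamma)=\{\pm q^k\gamma\mid k\in\mathbf Z\}$ and $\int_\gamma f=(1-q)\sum_{k\in\mathbf Z}\sum_{\epsilon=\pm1}q^k\gamma f(\epsilon q^k\gamma)$ when the sum converges absolutely. $\mathcal I_\gamma^\infty$ is the space of functions $f$ on $L(\gamma)$ such that for all $e\in\mathbf Z_{\ge0}$ this sum converges absolutely for $x\mapsto f(x)x^e$. For $f\in\mathcal I_\gamma^\infty$: $\mu_{e,\gamma}(f)=q^{(e^2+e)/2}\int_\gamma f(x)x^e$ and $\nu_{e,\gamma}(f)=q^{(e^2+e)/2}\int_\gamma|f(x)x^e|$. $q$-convolution: $(f*_\gamma g)(x)=\sum_{e=0}^\infty\frac{(-1)^e\mu_{e,\gamma}(f)}{[e]_q!}(\partial^e g)(x)$, at points $x$ where all $(\partial^eg)(x)$ are defined and the series converges absolutely. $\mathcal H^{\rm S}\mathcal I_{\gamma,\alpha}^{\rm s\omega}$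 is the set of $f\in\mathcal I_\gamma^\infty$ such that, for some $b>0$, $\nu_{e,\gamma}(f)=O(q^{\alpha e^2/2}b^e)$ as $e\to\infty$, and such that $f$ is the restriction to $L(\gamma)$ of a (necessarily unique) function holomorphic on some strip $\{z\in\mathbf C\mid|{\rm Im}(z)|<a\}$, $a>0$. "Determined by its moments" means: if $f_1,f_2$ in the space have $\mu_{e,\gamma}(f_1)=\mu_{e,\gamma}(f_2)$ for all $e$, then $f_1=f_2$.
   Formalization: The space is not closed under the q-convolution (for α>1/2 some f*f leaves it), so "commutative" is taken to mean that f*g = g*f on L(γ) whenever both convolutions converge on L(γ) and lie in the space; closure is not claimed. *)

theory Defs
  imports "HOL-Complex_Analysis.Complex_Analysis" "HOL-Library.Landau_Symbols"
begin

(* A function on the lattice L(gamma) is represented by a total function real => complex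
   whose values off L(gamma) are irrelevant; accordingly, functions are compared with eq_on_L. *)

definition qlattice :: "real \<Rightarrow> real \<Rightarrow> real set" where
  "qlattice q \<gamma> = {\<epsilon> * (q powi k * \<gamma>) | (k :: int) (\<epsilon> :: real). \<epsilon> \<in> {1, -1}}"

definition eq_on_L :: "real \<Rightarrow> real \<Rightarrow> (real \<Rightarrow> complex) \<Rightarrow> (real \<Rightarrow> complex) \<Rightarrow> bool" where
  "eq_on_L q \<gamma> f g \<longleftrightarrow> (\<forall>x\<in>qlattice q \<gamma>. f x = g x)"

definition qbracket :: "real \<Rightarrow> nat \<Rightarrow> real" where
  "qbracket q e = (1 - q ^ e) / (1 - q)"

definition qfact :: "real \<Rightarrow> nat \<Rightarrow> real" where
  "qfact q e = (\<Prod>i = 1..e. qbracket q i)"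

(* Used only at points of L(gamma), which does not contain 0 and is stable under x -> q x. *)
definition qderiv :: "real \<Rightarrow> (real \<Rightarrow> complex) \<Rightarrow> real \<Rightarrow> complex" where
  "qderiv q f x = (f x - f (q * x)) / of_real ((1 - q) * x)"

definition qint_term :: "real \<Rightarrow> real \<Rightarrow> (real \<Rightarrow> 'a::real_normed_vector) \<Rightarrow> int \<times> real \<Rightarrow> 'a" where
  "qint_term q \<gamma> f = (\<lambda>(k, \<epsilon>). (q powi k * \<gamma>) *\<^sub>R f (\<epsilon> * (q powi k * \<gamma>)))"

definition qintegrable :: "real \<Rightarrow> real \<Rightarrow> (real \<Rightarrow> 'a::real_normed_vector) \<Rightarrow> bool" where
  "qintegrable q \<gamma> f \<longleftrightarrow> qint_term q \<gamma> f abs_summable_on (UNIV \<times> {1, -1})"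

definition qint :: "real \<Rightarrow> real \<Rightarrow> (real \<Rightarrow> 'a::real_normed_vector) \<Rightarrow> 'a" where
  "qint q \<gamma> f = (1 - q) *\<^sub>R infsum (qint_term q \<gamma> f) (UNIV \<times> {1, -1})"

definition I_inf :: "real \<Rightarrow> real \<Rightarrow> (real \<Rightarrow> complex) set" where
  "I_inf q \<gamma> = {f. \<forall>e::nat. qintegrable q \<gamma> (\<lambda>x. f x * of_real x ^ e)}"

definition qmoment :: "real \<Rightarrow> real \<Rightarrow> nat \<Rightarrow> (real \<Rightarrow> complex) \<Rightarrow> complex" where
  "qmoment q \<gamma> e f =
     of_real (q ^ ((e\<^sup>2 + e) div 2)) * qint q \<gamma> (\<lambda>x. f x * of_real x ^ e)"

definition abs_qmoment :: "real \<Rightarrow> real \<Rightarrow> nat \<Rightarrow> (real \<Rightarrow> complex) \<Rightarrow> real" where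
  "abs_qmoment q \<gamma> e f =
     q ^ ((e\<^sup>2 + e) div 2) * qint q \<gamma> (\<lambda>x. cmod (f x * of_real x ^ e))"

definition HS_space :: "real \<Rightarrow> real \<Rightarrow> real \<Rightarrow> (real \<Rightarrow> complex) set" where
  "HS_space q \<gamma> \<alpha> = {f \<in> I_inf q \<gamma>.
     (\<exists>b>0. (\<lambda>e. abs_qmoment q \<gamma> e f) \<in> O(\<lambda>e. q powr (\<alpha> * (real e)\<^sup>2 / 2) * b ^ e)) \<and>
     (\<exists>a>0. \<exists>F. F holomorphic_on {z. \<bar>Im z\<bar> < a} \<and>
        (\<forall>x\<in>qlattice q \<gamma>. f x = F (of_real x)))}"

definition qconv_term ::
  "real \<Rightarrow> real \<Rightarrow> (real \<Rightarrow> complex) \<Rightarrow> (real \<Rightarrow> complex) \<Rightarrow> real \<Rightarrow> nat \<Rightarrow> complex" where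
  "qconv_term q \<gamma> f g x e =
     (-1) ^ e * qmoment q \<gamma> e f / of_real (qfact q e) * (qderiv q ^^ e) g x"

definition qconv_converges ::
  "real \<Rightarrow> real \<Rightarrow> (real \<Rightarrow> complex) \<Rightarrow> (real \<Rightarrow> complex) \<Rightarrow> real \<Rightarrow> bool" where
  "qconv_converges q \<gamma> f g x \<longleftrightarrow> summable (\<lambda>e. cmod (qconv_term q \<gamma> f g x e))"

definition qconv ::
  "real \<Rightarrow> real \<Rightarrow> (real \<Rightarrow> complex) \<Rightarrow> (real \<Rightarrow> complex) \<Rightarrow> real \<Rightarrow> complex" where
  "qconv q \<gamma> f g x = (\<Sum>e. qconv_term q \<gamma> f g x e)"

(* h is the product of f and g in the algebra: the convolution of f and g is defined on
   all of L(gamma), equals h there, and lies in the space.  A relation is used because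
   closure of HS_space under convolution is not built into the definitions. *)
definition is_HS_product ::
  "real \<Rightarrow> real \<Rightarrow> real \<Rightarrow> (real \<Rightarrow> complex) \<Rightarrow> (real \<Rightarrow> complex) \<Rightarrow> (real \<Rightarrow> complex) \<Rightarrow> bool" where
  "is_HS_product q \<gamma> \<alpha> f g h \<longleftrightarrow>
     h \<in> HS_space q \<gamma> \<alpha> \<and> (\<forall>x\<in>qlattice q \<gamma>. qconv_converges q \<gamma> f g x) \<and>
     eq_on_L q \<gamma> h (qconv q \<gamma> f g)"

definition HS_commutative :: "real \<Rightarrow> real \<Rightarrow> real \<Rightarrow> bool" where
  "HS_commutative q \<gamma> \<alpha> \<longleftrightarrow>
     (\<forall>f\<in>HS_space q \<gamma> \<alpha>. \<forall>g\<in>HS_space q \<gamma> \<alpha>. \<forall>h h'.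
        is_HS_product q \<gamma> \<alpha> f g h \<longrightarrow> is_HS_product q \<gamma> \<alpha> g f h' \<longrightarrow> eq_on_L q \<gamma> h h')"

definition HS_moment_determined :: "real \<Rightarrow> real \<Rightarrow> real \<Rightarrow> bool" where
  "HS_moment_determined q \<gamma> \<alpha> \<longleftrightarrow>
     (\<forall>f1\<in>HS_space q \<gamma> \<alpha>. \<forall>f2\<in>HS_space q \<gamma> \<alpha>.
        (\<forall>e. qmoment q \<gamma> e f1 = qmoment q \<gamma> e f2) \<longrightarrow> eq_on_L q \<gamma> f1 f2)"

end

(* The threshold is alpha = 1/2: for alpha > 1/2 both properties hold, for alpha <= 1/2 both fail.

   For every alpha > 0, q-integration by parts and an exchange of summations give
   mu_n(f * g) = sum_e [n]! / ([e]! [n-e]!) mu_e(f) mu_{n-e}(g), which is symmetric in f and g.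
   The exchange is legitimate because int |x^n D^e g| grows at most exponentially in e: near 0 by
   the power series of g, and away from 0 because D^(e+1) g (x) is controlled by D^e g at x and qx.
   So determinacy implies commutativity.

   If alpha > 1/2 and all moments of f vanish, test f against the even polynomials with zeros at the
   points +-q^k x0, k in [-N,M] - {0}, times (1 + x/x0).  The bound nu_d = O(q^(alpha d^2/2) b^d) beats
   the growth q^(N^2) |x|^(2N) of these polynomials exactly for alpha > 1/2; N -> oo and then
   M -> oo give f(x0) = 0.

   If alpha <= 1/2, put Theta(z) = prod_i (1 - q^(2i) z) = sum_j theta_j z^j and
   E(x) = Theta(x^2/gamma^2), which vanishes at the lattice points |x| >= gamma.  The function
   f_s(x) = sum_j theta_j q^((2s+1)j) E(q^j x) has n-th moment proportional to Theta(q^(2s-n)) for even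
   n and 0 for odd n.  Hence all moments of f_0 vanish, while f_1 has exactly one nonzero moment,
   mu_0, so that f_0 * f_1 = 0 but f_1 * f_0 = mu_0(f_1) f_0, and f_0 is not zero. *)
theory Submission
  imports Defs
begin

text \<open>Where 1/2 comes from: the test polynomial gains about \<open>q^(N^2)\<close> from its
  outer zeros, while the n-th absolute integral of f may grow like
  \<open>q^(-(1-\<alpha>)n^2/2)\<close>; at n = 2N the exponents add up to
  \<open>(2\<alpha>-1)N^2\<close>. In the counterexample the j-th summand contributes about
  \<open>q^(j^2-nj)\<close> to the n-th integral. The worst j = n/2 costs \<open>q^(-n^2/4)\<close>,
  and the factor \<open>q^(n^2/2)\<close> of the moments leaves \<open>q^(n^2/4)\<close>, the growth
  allowed for \<alpha> = 1/2. Theta plays two roles there. As a function of x it cuts off the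
  lattice from gamma on while remaining entire. As a power series in the dilation x -> qx it kills
  moments: a dilation multiplies the n-th integral by a scalar, so the series multiplies it by its
  value at that scalar. The convolution uses only moments of its left factor and q-derivatives of
  its right factor. A nonzero function without moments therefore annihilates from the left but need
  not do so from the right. Both products in the counterexample are computed outright, so that their
  membership in the space can be read off.\<close>

locale q_lattice =
  fixes q \<gamma> :: real
  assumes q_pos: "0 < q" and q_less_1: "q < 1" and gamma_pos: "0 < \<gamma>"
begin

abbreviation J :: "(int \<times> real) set" where
  "J \<equiv> UNIV \<times> {1, -1}"

abbreviation L :: "real set" where
  "L \<equiv> qlattice q \<gamma>"

section \<open>The q-integral as a weighted sum over lattice points\<close>

definition pt :: "int \<times> real \<Rightarrow> real" where
  "pt j = snd j * (q powi fst j * \<gamma>)"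

lemma L_eq_pt_image: "L = pt ` J"
proof -
  have "x \<in> L \<longleftrightarrow> (\<exists>j\<in>J. x = pt j)" for x
    unfolding qlattice_def pt_def by (simp add: Bex_def) blast
  then show ?thesis by blast
qed

lemma pt_in_L: "j \<in> J \<Longrightarrow> pt j \<in> L"
  by (auto simp: L_eq_pt_image)

lemma L_nonzero: "x \<in> L \<Longrightarrow> x \<noteq> 0"
  using q_pos gamma_pos by (force simp: qlattice_def)

lemma abs_pt: "j \<in> J \<Longrightarrow> \<bar>pt j\<bar> = q powi fst j * \<gamma>"
  using q_pos gamma_pos by (auto simp: pt_def abs_mult)

text \<open>The weight \<open>q^k * \<gamma>\<close> is the modulus of the point, so the q-integral
  is the sum of \<open>\<bar>x\<bar> f(x)\<close> over the lattice. In this form signs and exponents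
  need no separate treatment.\<close>

lemma qint_term_eq: "j \<in> J \<Longrightarrow> qint_term q \<gamma> f j = \<bar>pt j\<bar> *\<^sub>R f (pt j)"
  using abs_pt[of j] by (cases j) (auto simp: qint_term_def pt_def)

lemma L_shift: "x \<in> L \<Longrightarrow> q powi m * x \<in> L"
  unfolding qlattice_def
proof clarify
  fix k :: int and \<epsilon> :: real assume e: "\<epsilon> \<in> {1, -1}"
  have "q powi m * (\<epsilon> * (q powi k * \<gamma>)) = \<epsilon> * (q powi (m + k) * \<gamma>)"
    using q_pos by (simp add: power_int_add)
  then show "\<exists>k' \<epsilon>'. q powi m * (\<epsilon> * (q powi k * \<gamma>)) = \<epsilon>' * (q powi k' * \<gamma>) \<and> \<epsilon>' \<in> {1, -1}"
    using e by blast
qed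

lemma L_mult_q: "x \<in> L \<Longrightarrow> q * x \<in> L"
  using L_shift[of x 1] by simp

lemma qpower_gamma_in_L: "q powi k * \<gamma> \<in> L" "- (q powi k * \<gamma>) \<in> L"
  unfolding qlattice_def by force+

lemma qintegrable_iff:
  "qintegrable q \<gamma> f \<longleftrightarrow> (\<lambda>j. \<bar>pt j\<bar> * norm (f (pt j))) summable_on J"
  unfolding qintegrable_def by (intro summable_on_cong) (simp add: qint_term_eq)

lemma qint_eq: "qint q \<gamma> f = (1 - q) *\<^sub>R infsum (\<lambda>j. \<bar>pt j\<bar> *\<^sub>R f (pt j)) J"
  unfolding qint_def by (intro arg_cong[where f = "\<lambda>x. (1 - q) *\<^sub>R x"] infsum_cong) (simp add: qint_term_eq)

lemma qintegrable_summable: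
  fixes f :: "real \<Rightarrow> 'a :: banach"
  assumes "qintegrable q \<gamma> f"
  shows "(\<lambda>j. \<bar>pt j\<bar> *\<^sub>R f (pt j)) summable_on J"
  by (rule abs_summable_summable) (use assms in \<open>simp add: qintegrable_iff\<close>)

lemma qintegrable_cong:
  assumes "\<And>x. x \<in> L \<Longrightarrow> f x = g x"
  shows "qintegrable q \<gamma> f \<longleftrightarrow> qintegrable q \<gamma> g"
  unfolding qintegrable_iff using assms by (intro summable_on_cong) (simp add: pt_in_L)

lemma qint_cong:
  assumes "\<And>x. x \<in> L \<Longrightarrow> f x = g x"
  shows "qint q \<gamma> f = qint q \<gamma> g"
  unfolding qint_eq using assms
  by (intro arg_cong[where f = "\<lambda>x. (1 - q) *\<^sub>R x"] infsum_cong) (simp add: pt_in_L)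

lemma qintegrable_norm_iff: "qintegrable q \<gamma> (\<lambda>x. norm (f x)) \<longleftrightarrow> qintegrable q \<gamma> f"
  unfolding qintegrable_iff by simp

lemma qintegrable_mono:
  assumes "qintegrable q \<gamma> g" "\<And>x. x \<in> L \<Longrightarrow> norm (f x) \<le> norm (g x)"
  shows "qintegrable q \<gamma> f"
  using assms(1) unfolding qintegrable_iff
  by (rule summable_on_comparison_test)
     (auto simp del: mem_Sigma_iff intro!: mult_left_mono assms(2) pt_in_L)

lemma qint_mono:
  fixes f g :: "real \<Rightarrow> real"
  assumes "qintegrable q \<gamma> f" "qintegrable q \<gamma> g" "\<And>x. x \<in> L \<Longrightarrow> f x \<le> g x"
  shows "qint q \<gamma> f \<le> qint q \<gamma> g"
proof -
  have "infsum (\<lambda>j. \<bar>pt j\<bar> *\<^sub>R f (pt j)) J \<le> infsum (\<lambda>j. \<bar>pt j\<bar> *\<^sub>R g (pt j)) J"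
    using assms by (intro infsum_mono qintegrable_summable scaleR_left_mono assms(3) pt_in_L) auto
  then show ?thesis
    unfolding qint_eq using q_less_1 by (intro scaleR_left_mono) auto
qed

lemma qint_nonneg:
  fixes f :: "real \<Rightarrow> real"
  assumes "\<And>x. x \<in> L \<Longrightarrow> 0 \<le> f x"
  shows "0 \<le> qint q \<gamma> f"
  unfolding qint_eq real_scaleR_def using q_less_1
  by (intro mult_nonneg_nonneg infsum_nonneg) (auto simp del: mem_Sigma_iff simp: assms pt_in_L)

lemma norm_qint_le:
  assumes "qintegrable q \<gamma> f"
  shows "norm (qint q \<gamma> f) \<le> qint q \<gamma> (\<lambda>x. norm (f x))"
proof -
  have "norm (infsum (\<lambda>j. \<bar>pt j\<bar> *\<^sub>R f (pt j)) J) \<le> infsum (\<lambda>j. norm (\<bar>pt j\<bar> *\<^sub>R f (pt j))) J"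
    using assms by (intro norm_infsum_bound) (simp add: qintegrable_iff)
  then show ?thesis
    unfolding qint_eq using q_less_1 by (simp add: mult_left_mono)
qed

lemma qintegrable_add:
  assumes "qintegrable q \<gamma> f" "qintegrable q \<gamma> g"
  shows "qintegrable q \<gamma> (\<lambda>x. f x + g x)"
proof -
  have "(\<lambda>j. \<bar>pt j\<bar> * norm (f (pt j)) + \<bar>pt j\<bar> * norm (g (pt j))) summable_on J"
    using assms by (intro summable_on_add) (auto simp: qintegrable_iff)
  then show ?thesis
    unfolding qintegrable_iff
    by (rule summable_on_comparison_test)
       (auto simp flip: distrib_left intro!: mult_left_mono norm_triangle_ineq)
qed

lemma qint_add:
  fixes f g :: "real \<Rightarrow> 'a :: banach"
  assumes "qintegrable q \<gamma> f" "qintegrable q \<gamma> g"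
  shows "qint q \<gamma> (\<lambda>x. f x + g x) = qint q \<gamma> f + qint q \<gamma> g"
  unfolding qint_eq using qintegrable_summable[OF assms(1)] qintegrable_summable[OF assms(2)]
  by (simp add: scaleR_add_right infsum_add)

lemma qintegrable_cmult:
  fixes f :: "real \<Rightarrow> 'a :: real_normed_field"
  assumes "qintegrable q \<gamma> f"
  shows "qintegrable q \<gamma> (\<lambda>x. c * f x)"
  using summable_on_cmult_right[of "\<lambda>j. \<bar>pt j\<bar> * norm (f (pt j))" J "norm c"] assms
  unfolding qintegrable_iff by (simp add: norm_mult mult_ac)

lemma qint_cmult:
  fixes f :: "real \<Rightarrow> 'a :: real_normed_field"
  shows "qint q \<gamma> (\<lambda>x. c * f x) = c * qint q \<gamma> f"
proof -
  have "infsum (\<lambda>j. \<bar>pt j\<bar> *\<^sub>R (c * f (pt j))) J = infsum (\<lambda>j. c * (\<bar>pt j\<bar> *\<^sub>R f (pt j))) J"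
    by simp
  also have "\<dots> = c * infsum (\<lambda>j. \<bar>pt j\<bar> *\<^sub>R f (pt j)) J"
    by (rule infsum_cmult_right')
  finally have *: "infsum (\<lambda>j. \<bar>pt j\<bar> *\<^sub>R (c * f (pt j))) J = c * infsum (\<lambda>j. \<bar>pt j\<bar> *\<^sub>R f (pt j)) J" .
  show ?thesis
    unfolding qint_eq * by simp
qed

lemma qintegrable_diff:
  fixes f g :: "real \<Rightarrow> 'a :: real_normed_field"
  assumes "qintegrable q \<gamma> f" "qintegrable q \<gamma> g"
  shows "qintegrable q \<gamma> (\<lambda>x. f x - g x)"
  using qintegrable_add[OF assms(1) qintegrable_cmult[OF assms(2), of "-1"]] by simp

lemma qint_diff:
  fixes f g :: "real \<Rightarrow> 'a :: {banach, real_normed_field}"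
  assumes "qintegrable q \<gamma> f" "qintegrable q \<gamma> g"
  shows "qint q \<gamma> (\<lambda>x. f x - g x) = qint q \<gamma> f - qint q \<gamma> g"
  using qint_add[OF assms(1) qintegrable_cmult[OF assms(2), of "-1"]] qint_cmult[of "-1" g] by simp

section \<open>Dilations and reflection of the lattice\<close>

lemma bij_shift: "bij_betw (\<lambda>j. (fst j + m, snd j)) J J"
  by (rule bij_betwI[where g = "\<lambda>j. (fst j - m, snd j)"]) auto

lemma pt_shift: "pt (fst j + m, snd j) = q powi m * pt j"
  using q_pos by (simp add: pt_def power_int_add)

lemma qintegrable_scale:
  assumes "qintegrable q \<gamma> f"
  shows "qintegrable q \<gamma> (\<lambda>x. f (q powi m * x))"
proof -
  have "(\<lambda>j. \<bar>q powi m * pt j\<bar> * norm (f (q powi m * pt j))) summable_on J"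
    using assms unfolding qintegrable_iff
    by (subst (asm) summable_on_reindex_bij_betw[OF bij_shift[of m], symmetric]) (simp add: pt_shift)
  then have "(\<lambda>j. q powi (-m) * (\<bar>q powi m * pt j\<bar> * norm (f (q powi m * pt j)))) summable_on J"
    by (rule summable_on_cmult_right)
  then show ?thesis
    unfolding qintegrable_iff using q_pos by (simp add: abs_mult power_int_minus mult.assoc[symmetric])
qed

text \<open>A dilation permutes the lattice and multiplies the weight \<open>\<bar>x\<bar>\<close>
  by \<open>q powi m\<close>; this is the only source of the factor.\<close>

lemma qint_scale:
  fixes f :: "real \<Rightarrow> 'a :: real_normed_field"
  shows "qint q \<gamma> (\<lambda>x. f (q powi m * x)) = of_real (q powi (-m)) * qint q \<gamma> f"
proof -
  have "infsum (\<lambda>j. \<bar>pt j\<bar> *\<^sub>R f (pt j)) J = infsum (\<lambda>j. \<bar>q powi m * pt j\<bar> *\<^sub>R f (q powi m * pt j)) J"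
    by (subst infsum_reindex_bij_betw[OF bij_shift[of m], symmetric]) (simp add: pt_shift)
  also have "\<dots> = infsum (\<lambda>j. of_real (q powi m) * (\<bar>pt j\<bar> *\<^sub>R f (q powi m * pt j))) J"
    using q_pos by (simp add: abs_mult scaleR_conv_of_real mult_ac)
  also have "\<dots> = of_real (q powi m) * infsum (\<lambda>j. \<bar>pt j\<bar> *\<^sub>R f (q powi m * pt j)) J"
    by (rule infsum_cmult_right')
  finally show ?thesis
    unfolding qint_eq using q_pos by (simp add: power_int_minus field_simps)
qed

lemma qint_reflect:
  fixes f :: "real \<Rightarrow> 'a :: real_normed_field"
  shows "qint q \<gamma> (\<lambda>x. f (- x)) = qint q \<gamma> f"
proof -
  have b: "bij_betw (\<lambda>j. (fst j, - snd j)) J J"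
    by (rule bij_betwI[where g = "\<lambda>j. (fst j, - snd j)"]) auto
  show ?thesis
    unfolding qint_eq by (subst infsum_reindex_bij_betw[OF b, symmetric]) (simp add: pt_def)
qed

lemma summable_q_abs: "(\<lambda>j. q ^ nat \<bar>fst j\<bar>) summable_on J"
proof -
  have geo: "(\<lambda>n. q ^ n) summable_on (UNIV :: nat set)"
    using q_pos q_less_1 by (intro norm_summable_imp_summable_on) simp
  have 1: "(\<lambda>k. q ^ nat \<bar>k\<bar>) summable_on (range int)"
    using geo by (subst summable_on_reindex) (auto simp: o_def)
  have 2: "(\<lambda>k. q ^ nat \<bar>k\<bar>) summable_on (range (\<lambda>n. - int n))"
    using geo by (subst summable_on_reindex) (auto simp: o_def inj_on_def)
  have "k \<in> range int \<union> range (\<lambda>n. - int n)" for k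
    by (cases k rule: int_cases2) auto
  then have "range int \<union> range (\<lambda>n. - int n) = UNIV" by blast
  then have 3: "(\<lambda>k. q ^ nat \<bar>k\<bar>) summable_on (UNIV :: int set)"
    using summable_on_union[OF 1 2] by simp
  have 4: "(\<lambda>j. q ^ nat \<bar>fst j\<bar>) summable_on ((\<lambda>k. (k, c::real)) ` UNIV)" for c
    using 3 by (subst summable_on_reindex) (auto simp: o_def inj_on_def)
  have "J = (\<lambda>k. (k, 1::real)) ` UNIV \<union> (\<lambda>k. (k, -1::real)) ` UNIV" by auto
  then show ?thesis using summable_on_union[OF 4[of 1] 4[of "-1"]] by simp
qed

text \<open>Boundedness near 0 suffices because the weight decays geometrically towards 0, and only
  finitely many points lie between a given positive radius and \<open>r\<close>.\<close>

lemma qintegrable_bounded_support: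
  assumes "\<And>x. x \<in> L \<Longrightarrow> \<bar>x\<bar> \<le> r \<Longrightarrow> norm (f x) \<le> c" "\<And>x. x \<in> L \<Longrightarrow> r < \<bar>x\<bar> \<Longrightarrow> f x = 0"
  shows "qintegrable q \<gamma> f"
  unfolding qintegrable_iff
proof (rule summable_on_comparison_test)
  \<comment> \<open>One constant for both directions, with \<open>Q = q ^ nat \<bar>k\<bar>\<close>.
    For k \<ge> 0 the point has modulus \<open>\<gamma> * Q\<close>. For k < 0 it has modulus
    \<open>\<gamma> / Q \<le> r\<close>, hence \<open>\<gamma> / Q = (\<gamma> / Q)^2 * Q / \<gamma>
    \<le> r^2 / \<gamma> * Q\<close>.\<close>
  let ?C = "\<bar>c\<bar> * (\<gamma> + r\<^sup>2 / \<gamma>)"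
  show "(\<lambda>j. ?C * q ^ nat \<bar>fst j\<bar>) summable_on J"
    by (intro summable_on_cmult_right summable_q_abs)
  fix j assume j: "j \<in> J"
  show "\<bar>pt j\<bar> * norm (f (pt j)) \<le> ?C * q ^ nat \<bar>fst j\<bar>"
  proof (cases "\<bar>pt j\<bar> \<le> r")
    case False
    then have "f (pt j) = 0" using assms(2)[OF pt_in_L[OF j]] by simp
    then show ?thesis using gamma_pos q_pos by simp
  next
    case True
    have "\<bar>pt j\<bar> \<le> (\<gamma> + r\<^sup>2 / \<gamma>) * q ^ nat \<bar>fst j\<bar>"
    proof (cases "fst j \<ge> 0")
      case True
      then have "\<bar>pt j\<bar> = \<gamma> * q ^ nat \<bar>fst j\<bar>"
        using abs_pt[OF j] by (simp add: power_int_def)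
      then show ?thesis using gamma_pos q_pos by (simp add: mult_right_mono)
    next
      case False
      define Q where "Q = q ^ nat \<bar>fst j\<bar>"
      have Q: "Q > 0" using q_pos by (simp add: Q_def)
      have p: "\<bar>pt j\<bar> = \<gamma> / Q"
        using abs_pt[OF j] False by (simp add: power_int_def Q_def field_simps)
      have "\<gamma>\<^sup>2 / Q\<^sup>2 \<le> r\<^sup>2"
        using True p gamma_pos Q by (metis abs_ge_zero power_divide power_mono)
      then have "\<gamma> / Q \<le> r\<^sup>2 / \<gamma> * Q"
        using gamma_pos Q by (simp add: field_simps power2_eq_square)
      moreover have "0 \<le> \<gamma> * Q" using gamma_pos Q by simp
      ultimately show ?thesis unfolding p Q_def[symmetric] by (simp add: distrib_right)
    qed
    moreover have "norm (f (pt j)) \<le> \<bar>c\<bar>" using assms(1)[OF pt_in_L[OF j] True] by simp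
    ultimately have "\<bar>pt j\<bar> * norm (f (pt j)) \<le> (\<gamma> + r\<^sup>2 / \<gamma>) * q ^ nat \<bar>fst j\<bar> * \<bar>c\<bar>"
      by (intro mult_mono) auto
    then show ?thesis by (simp add: mult_ac)
  qed
qed auto

text \<open>One term of a sum of nonnegative terms is at most the sum. This turns integral bounds
  into bounds at single lattice points.\<close>

lemma norm_le_qint:
  assumes "qintegrable q \<gamma> f" "x \<in> L"
  shows "(1 - q) * \<bar>x\<bar> * norm (f x) \<le> qint q \<gamma> (\<lambda>x. norm (f x))"
proof -
  obtain j where j: "j \<in> J" "x = pt j" using assms(2) by (auto simp: L_eq_pt_image)
  have s: "(\<lambda>j. \<bar>pt j\<bar> * norm (f (pt j))) summable_on J"
    using assms(1) by (simp add: qintegrable_iff)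
  have "infsum (\<lambda>j. \<bar>pt j\<bar> * norm (f (pt j))) {j} \<le> infsum (\<lambda>j. \<bar>pt j\<bar> * norm (f (pt j))) J"
    using j by (intro infsum_mono2 s) auto
  then show ?thesis using j q_less_1 unfolding qint_eq by (simp add: mult.assoc)
qed

text \<open>Fubini and Tonelli for the counting measure on \<open>UNIV \<times> J\<close>.
  Summability of the absolute integrals makes the double family absolutely summable;
  \<open>norm_le_qint\<close> gives absolute convergence at each point.\<close>

lemma qint_sums:
  fixes T :: "nat \<Rightarrow> real \<Rightarrow> 'a :: banach"
  assumes int: "\<And>e. qintegrable q \<gamma> (T e)"
    and sum: "summable (\<lambda>e. qint q \<gamma> (\<lambda>x. norm (T e x)))"
  shows summable_norm_on_L: "\<And>x. x \<in> L \<Longrightarrow> summable (\<lambda>e. norm (T e x))"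
    and qintegrable_suminf: "qintegrable q \<gamma> (\<lambda>x. \<Sum>e. T e x)"
    and qint_suminf: "(\<lambda>e. qint q \<gamma> (T e)) sums qint q \<gamma> (\<lambda>x. \<Sum>e. T e x)"
proof -
  show pw: "summable (\<lambda>e. norm (T e x))" if x: "x \<in> L" for x
  proof -
    have "summable (\<lambda>e. qint q \<gamma> (\<lambda>x. norm (T e x)) / ((1 - q) * \<bar>x\<bar>))"
      using sum by (rule summable_divide)
    moreover have "norm (norm (T e x)) \<le> qint q \<gamma> (\<lambda>x. norm (T e x)) / ((1 - q) * \<bar>x\<bar>)" for e
      using norm_le_qint[OF int x, of e] L_nonzero[OF x] q_less_1 by (simp add: field_simps)
    ultimately show ?thesis by (rule summable_comparison_test'[where N = 0])
  qed
  define \<Phi> where "\<Phi> = (\<lambda>e j. \<bar>pt j\<bar> *\<^sub>R T e (pt j))"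
  have inner: "(\<lambda>j. norm (\<Phi> e j)) summable_on J" for e
    using int[of e] by (simp add: qintegrable_iff \<Phi>_def)
  have "infsum (\<lambda>j. norm (\<Phi> e j)) J = qint q \<gamma> (\<lambda>x. norm (T e x)) / (1 - q)" for e
    using q_less_1 by (simp add: qint_eq \<Phi>_def)
  then have "(\<lambda>e. infsum (\<lambda>j. norm (\<Phi> e j)) J) summable_on UNIV"
    by (subst summable_on_UNIV_nonneg_real_iff) (use q_less_1 in \<open>auto intro!: summable_divide sum qint_nonneg divide_nonneg_nonneg\<close>)
  then have abs: "(\<lambda>(e, j). \<Phi> e j) abs_summable_on UNIV \<times> J"
    using Infinite_Sum.abs_summable_on_Sigma_iff[where f = "\<lambda>(e, j). \<Phi> e j" and A = UNIV and B = "\<lambda>_. J"]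
    by (simp add: inner infsum_nonneg)
  \<comment> \<open>The same family with the lattice index outside: integrability of the pointwise
    sum needs the iterated sum in this order.\<close>
  have "(\<lambda>z. norm (case prod.swap z of (e, j) \<Rightarrow> \<Phi> e j)) summable_on J \<times> UNIV"
    using abs by (subst summable_on_reindex_bij_betw[where B = "UNIV \<times> J"]) (auto simp: bij_betw_def)
  then have abs': "(\<lambda>(j, e). \<Phi> e j) abs_summable_on J \<times> UNIV"
    by (simp add: case_prod_unfold)
  have \<Phi>_sum: "infsum (\<lambda>e. \<Phi> e j) UNIV = \<bar>pt j\<bar> *\<^sub>R (\<Sum>e. T e (pt j))" if j: "j \<in> J" for j
  proof (rule infsumI, rule norm_summable_imp_has_sum)
    have s: "summable (\<lambda>e. norm (T e (pt j)))" using pw[OF pt_in_L[OF j]] .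
    show "summable (\<lambda>e. norm (\<Phi> e j))" using summable_mult[OF s] by (simp add: \<Phi>_def)
    show "(\<lambda>e. \<Phi> e j) sums (\<bar>pt j\<bar> *\<^sub>R (\<Sum>e. T e (pt j)))"
      unfolding \<Phi>_def by (intro sums_scaleR_right summable_sums summable_norm_cancel[OF s])
  qed
  have nn: "(\<lambda>j. infsum (\<lambda>e. norm (\<Phi> e j)) UNIV) summable_on J"
    using iffD1[OF Infinite_Sum.abs_summable_on_Sigma_iff[where f = "\<lambda>(j, e). \<Phi> e j" and A = J and B = "\<lambda>_. UNIV"] abs'] by (simp add: infsum_nonneg)
  show "qintegrable q \<gamma> (\<lambda>x. \<Sum>e. T e x)"
    unfolding qintegrable_iff
  proof (rule summable_on_comparison_test[OF nn])
    fix j assume j: "j \<in> J"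
    have "(\<lambda>e. \<Phi> e j) abs_summable_on UNIV"
      using iffD1[OF Infinite_Sum.abs_summable_on_Sigma_iff[where f = "\<lambda>(j, e). \<Phi> e j" and A = J and B = "\<lambda>_. UNIV"] abs'] j by auto
    then have "norm (infsum (\<lambda>e. \<Phi> e j) UNIV) \<le> infsum (\<lambda>e. norm (\<Phi> e j)) UNIV"
      by (rule norm_infsum_bound)
    then show "\<bar>pt j\<bar> * norm (\<Sum>e. T e (pt j)) \<le> infsum (\<lambda>e. norm (\<Phi> e j)) UNIV"
      by (simp add: \<Phi>_sum[OF j])
  qed auto
  have summ: "(\<lambda>(e, j). \<Phi> e j) summable_on UNIV \<times> J"
    using abs by (rule Infinite_Sum.abs_summable_summable)
  have "(\<lambda>e. infsum (\<Phi> e) J) summable_on UNIV"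
    using summable_on_Sigma_banach[OF summ] by simp
  then have "((\<lambda>e. infsum (\<Phi> e) J) has_sum (infsum (\<lambda>e. infsum (\<Phi> e) J) UNIV)) UNIV"
    by (rule has_sum_infsum)
  then have "(\<lambda>e. infsum (\<Phi> e) J) sums (infsum (\<lambda>e. infsum (\<Phi> e) J) UNIV)"
    by (rule has_sum_imp_sums)
  also have "infsum (\<lambda>e. infsum (\<Phi> e) J) UNIV = infsum (\<lambda>j. infsum (\<lambda>e. \<Phi> e j) UNIV) J"
    using summ by (rule infsum_swap_banach)
  also have "\<dots> = infsum (\<lambda>j. \<bar>pt j\<bar> *\<^sub>R (\<Sum>e. T e (pt j))) J"
    by (rule infsum_cong) (rule \<Phi>_sum)
  finally have "(\<lambda>e. (1 - q) *\<^sub>R infsum (\<Phi> e) J)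
      sums ((1 - q) *\<^sub>R infsum (\<lambda>j. \<bar>pt j\<bar> *\<^sub>R (\<Sum>e. T e (pt j))) J)"
    by (rule sums_scaleR_right)
  then show "(\<lambda>e. qint q \<gamma> (T e)) sums qint q \<gamma> (\<lambda>x. \<Sum>e. T e x)"
    unfolding qint_eq \<Phi>_def .
qed

lemma qint_norm_suminf_le:
  fixes T :: "nat \<Rightarrow> real \<Rightarrow> 'a :: banach"
  assumes int: "\<And>e. qintegrable q \<gamma> (T e)"
    and sum: "summable (\<lambda>e. qint q \<gamma> (\<lambda>x. norm (T e x)))"
  shows "qint q \<gamma> (\<lambda>x. norm (\<Sum>e. T e x)) \<le> (\<Sum>e. qint q \<gamma> (\<lambda>x. norm (T e x)))"
proof -
  have int': "\<And>e. qintegrable q \<gamma> (\<lambda>x. norm (T e x))"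
    using int by (simp add: qintegrable_norm_iff)
  have sum': "summable (\<lambda>e. qint q \<gamma> (\<lambda>x. norm (norm (T e x))))"
    using sum by simp
  note n = qint_sums[OF int' sum']
  have "qint q \<gamma> (\<lambda>x. norm (\<Sum>e. T e x)) \<le> qint q \<gamma> (\<lambda>x. \<Sum>e. norm (T e x))"
    by (rule qint_mono)
       (auto simp: qintegrable_norm_iff intro!: qintegrable_suminf[OF int sum] n(2) summable_norm
          summable_norm_on_L[OF int sum])
  also have "\<dots> = (\<Sum>e. qint q \<gamma> (\<lambda>x. norm (T e x)))"
    using n(3) by (rule sums_unique)
  finally show ?thesis .
qed

section \<open>The q-integral of a q-derivative\<close>

lemma sum_int_telescope:
  fixes v :: "int \<Rightarrow> 'a :: ab_group_add"
  shows "(\<Sum>k\<in>{-int N..<int N}. v k - v (k + 1)) = v (-int N) - v (int N)"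
proof (induction N)
  case (Suc N)
  have "{-int (Suc N)..<int (Suc N)} = insert (-int (Suc N)) (insert (int N) {-int N..<int N})"
    by auto
  with Suc show ?case by (simp add: algebra_simps)
qed simp

text \<open>The factor \<open>\<bar>x\<bar>\<close> cancels the denominator of the q-derivative up
  to sign, so the integral telescopes on each half line. The boundary terms at infinity vanish by
  integrability. Those at 0 enter with opposite signs and cancel because both one-sided limits are
  the same \<open>l\<close>.\<close>

lemma qint_qderiv_eq_0:
  assumes u: "qintegrable q \<gamma> u" and du: "qintegrable q \<gamma> (qderiv q u)"
    and lim: "(\<lambda>N. u (q ^ N * \<gamma>)) \<longlonglongrightarrow> l" "(\<lambda>N. u (- (q ^ N * \<gamma>))) \<longlonglongrightarrow> l"
  shows "qint q \<gamma> (qderiv q u) = 0"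
proof -
  define T where "T = (\<lambda>j. \<bar>pt j\<bar> *\<^sub>R qderiv q u (pt j))"
  \<comment> \<open>Symmetric boxes exhaust \<open>J\<close>, so the unordered sum is the limit of
    sums that telescope on each half line.\<close>
  define BB where "BB = (\<lambda>N::nat. {-int N..<int N} \<times> {1, -1::real})"
  have T: "(T has_sum (infsum T J)) J"
    unfolding T_def by (rule has_sum_infsum[OF qintegrable_summable[OF du]])
  have BB: "filterlim BB (finite_subsets_at_top J) sequentially"
    unfolding filterlim_finite_subsets_at_top
  proof (intro allI impI)
    fix X :: "(int \<times> real) set" assume X: "finite X \<and> X \<subseteq> J"
    obtain M where M: "\<And>j. j \<in> X \<Longrightarrow> nat \<bar>fst j\<bar> \<le> M"
      using X finite_nat_set_iff_bounded_le[of "(\<lambda>j. nat \<bar>fst j\<bar>) ` X"] by auto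
    show "\<forall>\<^sub>F y in sequentially. finite (BB y) \<and> X \<subseteq> BB y \<and> BB y \<subseteq> J"
      using eventually_gt_at_top[of M]
    proof eventually_elim
      case (elim N)
      have "j \<in> BB N" if "j \<in> X" for j
        using M[OF that] elim X that by (cases j) (auto simp: BB_def)
      then show ?case by (auto simp: BB_def)
    qed
  qed
  have tend: "(\<lambda>N. sum T (BB N)) \<longlonglongrightarrow> infsum T J"
    using T BB unfolding has_sum_def by (rule filterlim_compose)
  have Tk: "T (k, \<epsilon>) = of_real \<epsilon> * (u (\<epsilon> * (q powi k * \<gamma>)) - u (\<epsilon> * (q powi (k+1) * \<gamma>))) / of_real (1 - q)"
    if "\<epsilon> \<in> {1, -1}" for k \<epsilon>
    using that q_pos q_less_1 gamma_pos
    by (auto simp: T_def pt_def qderiv_def scaleR_conv_of_real power_int_add abs_mult field_simps)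
  have "sum T (BB N) = (\<Sum>\<epsilon>\<in>{1,-1}. \<Sum>k\<in>{-int N..<int N}. T (k, \<epsilon>))" for N
    unfolding BB_def by (subst sum.swap) (simp only: sum.cartesian_product case_prod_eta)
  also have "\<dots> N = (\<Sum>\<epsilon>\<in>{1,-1}. of_real \<epsilon> * (\<Sum>k\<in>{-int N..<int N}.
       u (\<epsilon> * (q powi k * \<gamma>)) - u (\<epsilon> * (q powi (k+1) * \<gamma>))) / of_real (1 - q))" for N
    by (intro sum.cong refl) (simp add: Tk sum_distrib_left sum_divide_distrib)
  also have "\<dots> N = (u (q powi (- int N) * \<gamma>) - u (q ^ N * \<gamma>)
      - (u (- (q powi (- int N) * \<gamma>)) - u (- (q ^ N * \<gamma>)))) / of_real (1 - q)" for N
    by (subst sum_int_telescope) (simp add: diff_divide_distrib)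
  finally have S: "sum T (BB N) = (u (q powi (- int N) * \<gamma>) - u (q ^ N * \<gamma>)
      - (u (- (q powi (- int N) * \<gamma>)) - u (- (q ^ N * \<gamma>)))) / of_real (1 - q)" for N .
  have far: "(\<lambda>N. u (\<epsilon> * (q powi (- int N) * \<gamma>))) \<longlonglongrightarrow> 0" if e: "\<epsilon> \<in> {1, -1}" for \<epsilon>
  proof -
    have "(\<lambda>j. \<bar>pt j\<bar> * norm (u (pt j))) summable_on ((\<lambda>N. (- int N, \<epsilon>)) ` UNIV)"
      using u e by (auto simp: qintegrable_iff intro: summable_on_subset_banach)
    then have "(\<lambda>N. \<bar>pt (- int N, \<epsilon>)\<bar> * norm (u (pt (- int N, \<epsilon>)))) summable_on UNIV"
      by (subst (asm) summable_on_reindex) (auto simp: inj_on_def o_def)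
    then have "(\<lambda>N. \<bar>pt (- int N, \<epsilon>)\<bar> * norm (u (pt (- int N, \<epsilon>)))) \<longlonglongrightarrow> 0"
      by (intro summable_LIMSEQ_zero summable_on_imp_summable)
    then have "(\<lambda>N. inverse \<gamma> * (\<bar>pt (- int N, \<epsilon>)\<bar> * norm (u (pt (- int N, \<epsilon>))))) \<longlonglongrightarrow> inverse \<gamma> * 0"
      by (intro tendsto_intros)
    then have "(\<lambda>N. inverse \<gamma> * (\<bar>pt (- int N, \<epsilon>)\<bar> * norm (u (pt (- int N, \<epsilon>))))) \<longlonglongrightarrow> 0" by simp
    then have "(\<lambda>N. u (pt (- int N, \<epsilon>))) \<longlonglongrightarrow> 0"
    proof (rule Lim_null_comparison[rotated], intro always_eventually allI)
      fix N
      have "1 \<le> inverse (q ^ N)" using q_pos q_less_1 by (simp add: one_le_inverse_iff power_le_one)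
      then have "1 \<le> inverse \<gamma> * \<bar>pt (- int N, \<epsilon>)\<bar>"
        using abs_pt[of "(- int N, \<epsilon>)"] e gamma_pos by (auto simp: power_int_minus field_simps)
      then show "norm (u (pt (- int N, \<epsilon>))) \<le> inverse \<gamma> * (\<bar>pt (- int N, \<epsilon>)\<bar> * norm (u (pt (- int N, \<epsilon>))))"
        using mult_right_mono[of 1 "inverse \<gamma> * \<bar>pt (- int N, \<epsilon>)\<bar>" "norm (u (pt (- int N, \<epsilon>)))"]
        by (simp add: mult.assoc)
    qed
    then show ?thesis by (simp add: pt_def)
  qed
  have "(\<lambda>N. sum T (BB N)) \<longlonglongrightarrow> (0 - l - (0 - l)) / of_real (1 - q)"
    unfolding S using far[of 1] far[of "-1"] q_less_1 by (intro tendsto_intros lim) auto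
  then have "infsum T J = 0" using tend LIMSEQ_unique by fastforce
  then show ?thesis by (simp add: qint_eq T_def)
qed

section \<open>Moment bounds in the function space\<close>

lemma q_power_triangle: "q ^ ((e\<^sup>2 + e) div 2) = q powr (((real e)\<^sup>2 + real e) / 2)"
proof -
  have "real ((e\<^sup>2 + e) div 2) = ((real e)\<^sup>2 + real e) / 2"
    by (subst real_of_nat_div) auto
  then show ?thesis using q_pos by (metis powr_realpow)
qed

lemma HS_integrable: "f \<in> HS_space q \<gamma> \<alpha> \<Longrightarrow> qintegrable q \<gamma> (\<lambda>x. f x * of_real x ^ e)"
  by (simp add: HS_space_def I_inf_def)

lemma abs_qmoment_nonneg: "0 \<le> abs_qmoment q \<gamma> e f"
  unfolding abs_qmoment_def using q_pos by (intro mult_nonneg_nonneg qint_nonneg) auto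

text \<open>The O-bound holds only from some index on. The finitely many earlier values are absorbed
  by adding their quotients by the positive comparison function to the constant.\<close>

lemma HS_bound:
  assumes "f \<in> HS_space q \<gamma> \<alpha>"
  obtains C B where "C > 0" "B > 0"
    "\<And>e. abs_qmoment q \<gamma> e f \<le> C * (q powr (\<alpha> * (real e)\<^sup>2 / 2) * B ^ e)"
proof -
  obtain B where B: "B > 0"
    and O: "(\<lambda>e. abs_qmoment q \<gamma> e f) \<in> O(\<lambda>e. q powr (\<alpha> * (real e)\<^sup>2 / 2) * B ^ e)"
    using assms by (auto simp: HS_space_def)
  define r where "r = (\<lambda>e::nat. q powr (\<alpha> * (real e)\<^sup>2 / 2) * B ^ e)"
  have r: "r e > 0" for e using q_pos B by (simp add: r_def)
  obtain c where c: "c > 0" "\<forall>\<^sub>F e in sequentially. norm (abs_qmoment q \<gamma> e f) \<le> c * norm (r e)"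
    using O unfolding r_def[symmetric] by (elim landau_o.bigE)
  then obtain N where N: "\<And>e. e \<ge> N \<Longrightarrow> abs_qmoment q \<gamma> e f \<le> c * r e"
    using r by (force simp: eventually_at_top_linorder abs_qmoment_nonneg less_imp_le)
  define C where "C = c + (\<Sum>e<N. abs_qmoment q \<gamma> e f / r e)"
  have S: "(\<Sum>e<N. abs_qmoment q \<gamma> e f / r e) \<ge> 0"
    using r by (intro sum_nonneg divide_nonneg_pos abs_qmoment_nonneg) auto
  have "abs_qmoment q \<gamma> e f \<le> C * r e" for e
  proof (cases "e < N")
    case True
    then have "abs_qmoment q \<gamma> e f / r e \<le> (\<Sum>e<N. abs_qmoment q \<gamma> e f / r e)"
      using r by (intro member_le_sum divide_nonneg_pos abs_qmoment_nonneg) auto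
    then have "abs_qmoment q \<gamma> e f / r e \<le> C" using c by (simp add: C_def)
    then show ?thesis using r[of e] by (simp add: field_simps)
  next
    case False
    have "c * r e \<le> C * r e" using S r[of e] by (simp add: C_def)
    then show ?thesis using N[of e] False by simp
  qed
  moreover have "C > 0" using c S by (simp add: C_def)
  ultimately show thesis using that B unfolding r_def by blast
qed

lemma norm_qmoment_le:
  assumes "f \<in> HS_space q \<gamma> \<alpha>"
  shows "cmod (qmoment q \<gamma> e f) \<le> abs_qmoment q \<gamma> e f"
  unfolding qmoment_def abs_qmoment_def using q_pos norm_qint_le[OF HS_integrable[OF assms, of e]]
  by (simp add: norm_mult mult_left_mono norm_power)

text \<open>Supplies the products of the counterexample: the zero function (\<open>c = 0\<close>)
  and a scalar multiple of a given element.\<close>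

lemma HS_cmult:
  assumes "f \<in> HS_space q \<gamma> \<alpha>"
  shows "(\<lambda>x. c * f x) \<in> HS_space q \<gamma> \<alpha>"
proof -
  have I: "qintegrable q \<gamma> (\<lambda>x. c * f x * of_real x ^ e)" for e
    using qintegrable_cmult[OF HS_integrable[OF assms, of e], of c] by (simp add: mult.assoc)
  have m: "abs_qmoment q \<gamma> e (\<lambda>x. c * f x) = cmod c * abs_qmoment q \<gamma> e f" for e
    using qint_cmult[of "cmod c" "\<lambda>x. cmod (f x * of_real x ^ e)"]
    by (simp add: abs_qmoment_def norm_mult mult_ac)
  obtain b where b: "b > 0" "(\<lambda>e. abs_qmoment q \<gamma> e f) \<in> O(\<lambda>e. q powr (\<alpha> * (real e)\<^sup>2 / 2) * b ^ e)"
    using assms by (auto simp: HS_space_def)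
  have O: "(\<lambda>e. cmod c * abs_qmoment q \<gamma> e f) \<in> O(\<lambda>e. q powr (\<alpha> * (real e)\<^sup>2 / 2) * b ^ e)"
    using b(2) by (cases "c = 0") auto
  obtain a F where F: "a > 0" "F holomorphic_on {z. \<bar>Im z\<bar> < a}" "\<forall>x\<in>L. f x = F (of_real x)"
    using assms by (auto simp: HS_space_def)
  have "(\<lambda>z. c * F z) holomorphic_on {z. \<bar>Im z\<bar> < a}"
    by (intro holomorphic_intros F)
  then show ?thesis
    using I b(1) O F(1,3) unfolding HS_space_def I_inf_def mem_Collect_eq m
    by (intro conjI allI exI[of _ b] exI[of _ a] exI[of _ "\<lambda>z. c * F z"]) auto
qed

subsection \<open>Moments of a convolution\<close>

text \<open>On coefficients the q-derivative is a shift with factor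
  \<open>(1 - q^(n+1)) / (1 - q)\<close>, which is at most \<open>1 / (1 - q)\<close>. Unlike the
  factor n + 1 of the ordinary derivative it is bounded, so the radius does not shrink and e
  derivatives cost only an exponential factor instead of a factorial.\<close>

lemma qderiv_power_series:
  assumes bound: "\<And>n. norm (c n) \<le> C * R ^ n" and "C \<ge> 0" "R \<ge> 0"
    and series: "\<And>x. x \<in> L \<Longrightarrow> \<bar>x\<bar> * R < 1 \<Longrightarrow> (\<lambda>n. c n * of_real x ^ n) sums u x"
  shows "\<exists>d. (\<forall>n. norm (d n) \<le> C * (R / (1 - q)) ^ e * R ^ n) \<and>
    (\<forall>x\<in>L. \<bar>x\<bar> * R < 1 \<longrightarrow> (\<lambda>n. d n * of_real x ^ n) sums (qderiv q ^^ e) u x)"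
proof (induction e)
  case 0
  show ?case using bound series by (intro exI[of _ c]) auto
next
  case (Suc e)
  define C' where "C' = C * (R / (1 - q)) ^ e"
  obtain d where d: "\<And>n. norm (d n) \<le> C' * R ^ n"
    and s: "\<And>x. x \<in> L \<Longrightarrow> \<bar>x\<bar> * R < 1 \<Longrightarrow> (\<lambda>n. d n * of_real x ^ n) sums (qderiv q ^^ e) u x"
    using Suc unfolding C'_def by blast
  have C': "C' \<ge> 0" using assms(2,3) q_less_1 by (simp add: C'_def)
  define d' where "d' = (\<lambda>n. d (Suc n) * of_real ((1 - q ^ Suc n) / (1 - q)))"
  have "norm (d' n) \<le> C' * (R / (1 - q)) * R ^ n" for n
  proof -
    have "0 \<le> 1 - q ^ Suc n" "1 - q ^ Suc n \<le> 1"
      using power_le_one[of q "Suc n"] q_pos q_less_1 by (auto simp del: power_Suc)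
    then have "norm (of_real ((1 - q ^ Suc n) / (1 - q)) :: complex) \<le> 1 / (1 - q)"
      using q_less_1 by (simp only: norm_of_real) (simp add: divide_right_mono del: power_Suc)
    then have "norm (d' n) \<le> C' * R ^ Suc n * (1 / (1 - q))"
      unfolding d'_def norm_mult using C' assms(3) by (intro mult_mono d) auto
    then show ?thesis by (simp add: mult_ac)
  qed
  moreover have "(\<lambda>n. d' n * of_real x ^ n) sums (qderiv q ^^ Suc e) u x"
    if x: "x \<in> L" and xR: "\<bar>x\<bar> * R < 1" for x
  proof -
    have x0: "x \<noteq> 0" using L_nonzero[OF x] .
    have "\<bar>q * x\<bar> * R \<le> \<bar>x\<bar> * R"
      using q_pos q_less_1 assms(3) by (intro mult_right_mono) (auto simp: abs_mult intro: mult_left_le_one_le)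
    then have "(\<lambda>n. d n * of_real x ^ n - d n * of_real (q * x) ^ n) sums
        ((qderiv q ^^ e) u x - (qderiv q ^^ e) u (q * x))"
      using xR by (intro sums_diff s x L_mult_q) auto
    then have "(\<lambda>n. d (Suc n) * of_real x ^ Suc n - d (Suc n) * of_real (q * x) ^ Suc n) sums
        ((qderiv q ^^ e) u x - (qderiv q ^^ e) u (q * x))"
      by (subst sums_Suc_iff) simp
    then have "(\<lambda>n. (d (Suc n) * of_real x ^ Suc n - d (Suc n) * of_real (q * x) ^ Suc n) / of_real ((1 - q) * x))
        sums (((qderiv q ^^ e) u x - (qderiv q ^^ e) u (q * x)) / of_real ((1 - q) * x))"
      by (rule sums_divide)
    also have "(\<lambda>n. (d (Suc n) * of_real x ^ Suc n - d (Suc n) * of_real (q * x) ^ Suc n) / of_real ((1 - q) * x))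
        = (\<lambda>n. d' n * of_real x ^ n)"
      using x0 q_less_1 by (auto simp: d'_def fun_eq_iff field_simps)
    finally show ?thesis by (simp add: qderiv_def[of q _ x])
  qed
  ultimately show ?case
    by (intro exI[of _ d']) (auto simp: C'_def mult_ac)
qed

text \<open>Holomorphy at 0 is used for two things: an exponential bound on all q-derivatives in a
  fixed neighbourhood, and a limit at 0 that is the same from both sides (the constant coefficient).
  The latter is the boundary condition of \<open>qint_qderiv_eq_0\<close>.\<close>

lemma HS_near_zero:
  assumes "f \<in> HS_space q \<gamma> \<alpha>"
  obtains C K r where "r > 0" "C \<ge> 0" "K \<ge> 0"
    "\<And>e x. x \<in> L \<Longrightarrow> \<bar>x\<bar> \<le> r \<Longrightarrow> cmod ((qderiv q ^^ e) f x) \<le> C * K ^ e"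
    "\<And>e. \<exists>l M. \<forall>x\<in>L. \<bar>x\<bar> \<le> r \<longrightarrow> cmod ((qderiv q ^^ e) f x - l) \<le> M * \<bar>x\<bar>"
proof -
  obtain a F where a: "a > 0" and F: "F holomorphic_on {z. \<bar>Im z\<bar> < a}" and fF: "\<forall>x\<in>L. f x = F (of_real x)"
    using assms by (auto simp: HS_space_def)
  have "ball 0 a \<subseteq> {z. \<bar>Im z\<bar> < a}"
    by (auto intro: le_less_trans[OF abs_Im_le_cmod])
  then have hol: "F holomorphic_on ball 0 a" using F holomorphic_on_subset by blast
  define c where "c = (\<lambda>n. (deriv ^^ n) F 0 / fact n)"
  have c: "(\<lambda>n. c n * w ^ n) sums F w" if "cmod w < a" for w
    using holomorphic_power_series[OF hol, of w] that by (simp add: c_def)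
  \<comment> \<open>The Taylor series converges at \<open>a / 2\<close>, so its terms there are
    bounded, and \<open>norm (c n) \<le> C * R ^ n\<close> follows with \<open>R\<close> the inverse
    of \<open>a / 2\<close>.\<close>
  define R where "R = 2 / a"
  have R: "R > 0" using a by (simp add: R_def)
  have "Bseq (\<lambda>n. c n * of_real (a / 2) ^ n)"
    using a by (intro summable_imp_Bseq sums_summable[OF c]) auto
  then obtain C where C: "C > 0" "\<And>n. norm (c n * of_real (a / 2) ^ n) \<le> C"
    by (auto simp: Bseq_def)
  have cb: "norm (c n) \<le> C * R ^ n" for n
  proof -
    have "norm (c n) * (a / 2) ^ n \<le> C" using C(2)[of n] a by (simp add: norm_mult norm_power)
    then show ?thesis using a by (simp add: R_def field_simps power_divide)
  qed
  have ser: "(\<lambda>n. c n * of_real x ^ n) sums f x" if "x \<in> L" "\<bar>x\<bar> * R < 1" for x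
    using c[of "of_real x"] that a fF by (simp add: R_def field_simps)
  \<comment> \<open>On the radius \<open>1 / (2 * R)\<close> the ratio
    \<open>\<bar>x\<bar> * R\<close> is at most 1/2, so the tail is dominated by a geometric series
    with sum 2.\<close>
  have main: "\<exists>l. \<forall>x\<in>L. \<bar>x\<bar> \<le> 1 / (2 * R) \<longrightarrow>
      cmod ((qderiv q ^^ e) f x - l) \<le> 2 * (C * (R / (1 - q)) ^ e) * R * \<bar>x\<bar> \<and>
      cmod ((qderiv q ^^ e) f x) \<le> 2 * C * (R / (1 - q)) ^ e" for e
  proof -
    define C' where "C' = C * (R / (1 - q)) ^ e"
    have "\<exists>d. (\<forall>n. norm (d n) \<le> C' * R ^ n) \<and>
        (\<forall>x\<in>L. \<bar>x\<bar> * R < 1 \<longrightarrow> (\<lambda>n. d n * of_real x ^ n) sums (qderiv q ^^ e) f x)"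
      unfolding C'_def by (rule qderiv_power_series[OF cb _ _ ser]) (use C R in auto)
    then obtain d where d: "\<And>n. norm (d n) \<le> C' * R ^ n"
      and s: "\<And>x. x \<in> L \<Longrightarrow> \<bar>x\<bar> * R < 1 \<Longrightarrow> (\<lambda>n. d n * of_real x ^ n) sums (qderiv q ^^ e) f x"
      by blast
    have C': "C' > 0" using C(1) R q_less_1 by (simp add: C'_def)
    have "cmod ((qderiv q ^^ e) f x - d 0) \<le> 2 * C' * R * \<bar>x\<bar> \<and> cmod ((qderiv q ^^ e) f x) \<le> 2 * C'"
      if x: "x \<in> L" and xr: "\<bar>x\<bar> \<le> 1 / (2 * R)" for x
    proof -
      have xR: "\<bar>x\<bar> * R \<le> 1 / 2" using xr R by (simp add: field_simps)
      have "(\<lambda>n. d (Suc n) * of_real x ^ Suc n) sums ((qderiv q ^^ e) f x - d 0)"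
        using s[OF x] xR by (subst sums_Suc_iff) simp
      moreover have "(\<lambda>n. C' * R * \<bar>x\<bar> * (1 / 2) ^ n) sums (C' * R * \<bar>x\<bar> * (1 / (1 - 1 / 2)))"
        by (intro sums_mult geometric_sums) simp
      moreover have "norm (d (Suc n) * of_real x ^ Suc n) \<le> C' * R * \<bar>x\<bar> * (1 / 2) ^ n" for n
      proof -
        have "norm (d (Suc n) * of_real x ^ Suc n) \<le> C' * R ^ Suc n * \<bar>x\<bar> ^ Suc n"
          unfolding norm_mult norm_power norm_of_real using d[of "Suc n"] by (intro mult_right_mono) auto
        also have "\<dots> = C' * R * \<bar>x\<bar> * (\<bar>x\<bar> * R) ^ n" by (simp add: power_mult_distrib mult_ac)
        also have "\<dots> \<le> C' * R * \<bar>x\<bar> * (1 / 2) ^ n"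
          using xR R C' by (intro mult_left_mono power_mono) auto
        finally show ?thesis .
      qed
      ultimately have *: "cmod ((qderiv q ^^ e) f x - d 0) \<le> C' * R * \<bar>x\<bar> * (1 / (1 - 1 / 2))"
        by (rule norm_sums_le)
      have "C' * (\<bar>x\<bar> * R) \<le> C' * (1 / 2)"
        using xR C' by (intro mult_left_mono) auto
      moreover have "cmod (d 0) \<le> C'" using d[of 0] by simp
      ultimately have "cmod ((qderiv q ^^ e) f x) \<le> 2 * C'"
        using * norm_triangle_sub[of "(qderiv q ^^ e) f x" "d 0"] by (simp add: mult_ac)
      then show ?thesis using * by simp
    qed
    then show ?thesis unfolding C'_def[symmetric] mult.assoc[of 2 C] by blast
  qed
  show thesis
  proof (rule that[of "1 / (2 * R)" "2 * C" "R / (1 - q)"])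
    show "\<exists>l M. \<forall>x\<in>L. \<bar>x\<bar> \<le> 1 / (2 * R) \<longrightarrow> cmod ((qderiv q ^^ e) f x - l) \<le> M * \<bar>x\<bar>" for e
      using main[of e] by blast
    show "cmod ((qderiv q ^^ e) f x) \<le> 2 * C * (R / (1 - q)) ^ e" if "x \<in> L" "\<bar>x\<bar> \<le> 1 / (2 * R)" for e x
      using main[of e] that by blast
  qed (use R C q_less_1 in auto)
qed

text \<open>Near 0 the power series bound applies. Away from 0 the denominator
  \<open>(1 - q) * \<bar>x\<bar>\<close> is bounded below, so there a q-derivative is a bounded
  operation on the weighted integrals. Together this gives a linear recursion in e, hence
  exponential growth.\<close>

lemma HS_qderiv_bound:
  assumes f: "f \<in> HS_space q \<gamma> \<alpha>"
  obtains M K where "M \<ge> 0" "K \<ge> 0"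
    "\<And>e. qintegrable q \<gamma> (\<lambda>x. (qderiv q ^^ e) f x * of_real x ^ n)"
    "\<And>e. qint q \<gamma> (\<lambda>x. cmod ((qderiv q ^^ e) f x * of_real x ^ n)) \<le> M * K ^ e"
proof -
  obtain C K r where r: "r > 0" and C: "C \<ge> 0" and K: "K \<ge> 0"
    and near: "\<And>e x. x \<in> L \<Longrightarrow> \<bar>x\<bar> \<le> r \<Longrightarrow> cmod ((qderiv q ^^ e) f x) \<le> C * K ^ e"
    using HS_near_zero[OF f] by metis
  define U :: "real \<Rightarrow> real" where "U = (\<lambda>x. if \<bar>x\<bar> \<le> r then \<bar>x\<bar> ^ n else 0)"
  have U: "qintegrable q \<gamma> U"
    by (rule qintegrable_bounded_support[of r _ "r ^ n"]) (auto simp: U_def intro: power_mono)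
  have U0: "U x \<ge> 0" for x by (simp add: U_def)
  define D where "D = (\<lambda>e x. cmod ((qderiv q ^^ e) f x * of_real x ^ n))"
  define \<kappa> where "\<kappa> = 1 / ((1 - q) * r)"
  have \<kappa>: "\<kappa> > 0" using r q_less_1 by (simp add: \<kappa>_def)
  \<comment> \<open>The first summand dominates for \<open>\<bar>x\<bar> \<le> r\<close>, the second
    for \<open>\<bar>x\<bar> > r\<close>; since both are nonnegative, their sum dominates
    everywhere. The factor \<open>inverse q ^ n\<close> turns \<open>(q * x)^n\<close> back into
    \<open>x^n\<close>, and \<open>q powi 1\<close> is the shape that \<open>qint_scale\<close>
    expects.\<close>
  define bd where "bd = (\<lambda>e x. C * K ^ Suc e * U x + \<kappa> * (D e x + inverse q ^ n * D e (q powi 1 * x)))"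
  have step: "D (Suc e) x \<le> bd e x" if x: "x \<in> L" for e x
  proof (cases "\<bar>x\<bar> \<le> r")
    case True
    have "D (Suc e) x \<le> C * K ^ Suc e * U x"
      unfolding D_def norm_mult norm_power norm_of_real using near[OF x True, of "Suc e"] True
      by (simp add: U_def mult_right_mono)
    moreover have "0 \<le> \<kappa> * (D e x + inverse q ^ n * D e (q powi 1 * x))"
      using \<kappa> q_pos by (simp add: D_def)
    ultimately show ?thesis by (simp add: bd_def)
  next
    case False
    let ?D = "(qderiv q ^^ e) f"
    have x0: "x \<noteq> 0" using L_nonzero[OF x] .
    have "D (Suc e) x = cmod (?D x - ?D (q * x)) * \<bar>x\<bar> ^ n / ((1 - q) * \<bar>x\<bar>)"
      using q_less_1 by (simp add: D_def qderiv_def[of q _ x] norm_mult norm_divide norm_power abs_mult del: of_real_mult of_real_diff)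
    also have "\<dots> \<le> cmod (?D x - ?D (q * x)) * \<bar>x\<bar> ^ n / ((1 - q) * r)"
      using False q_less_1 r by (intro divide_left_mono mult_left_mono mult_pos_pos) auto
    also have "\<dots> = \<kappa> * (cmod (?D x - ?D (q * x)) * \<bar>x\<bar> ^ n)" by (simp add: \<kappa>_def)
    also have "\<dots> \<le> \<kappa> * ((cmod (?D x) + cmod (?D (q * x))) * \<bar>x\<bar> ^ n)"
      using \<kappa> by (intro mult_left_mono mult_right_mono norm_triangle_ineq4) auto
    also have "\<dots> = \<kappa> * (D e x + inverse q ^ n * D e (q powi 1 * x))"
      using q_pos by (simp add: D_def norm_mult norm_power abs_mult power_mult_distrib field_simps)
    also have "\<dots> \<le> bd e x" using C K U0[of x] by (simp add: bd_def)
    finally show ?thesis .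
  qed
  have I: "qintegrable q \<gamma> (D e)" for e
  proof (induction e)
    case 0
    show ?case using HS_integrable[OF f, of n] by (simp add: D_def qintegrable_norm_iff)
  next
    case (Suc e)
    have "qintegrable q \<gamma> (bd e)"
      unfolding bd_def by (intro qintegrable_add qintegrable_cmult Suc U qintegrable_scale[OF Suc])
    moreover have "norm (D (Suc e) x) \<le> norm (bd e x)" if "x \<in> L" for x
      using step[OF that, of e] by (simp add: D_def)
    ultimately show ?case by (rule qintegrable_mono)
  qed
  define a where "a = (\<lambda>e. qint q \<gamma> (D e))"
  have a0: "a e \<ge> 0" for e unfolding a_def by (rule qint_nonneg) (simp add: D_def)
  define QU where "QU = qint q \<gamma> U"
  have QU: "QU \<ge> 0" unfolding QU_def by (rule qint_nonneg) (rule U0)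
  \<comment> \<open>The exponent is \<open>Suc n\<close> because the dilation contributes one
    further \<open>inverse q\<close> through the weight.\<close>
  define \<kappa>' where "\<kappa>' = \<kappa> * (1 + inverse q ^ Suc n)"
  have \<kappa>': "\<kappa>' \<ge> 0" using \<kappa> q_pos by (simp add: \<kappa>'_def)
  have rec: "a (Suc e) \<le> C * K ^ Suc e * QU + \<kappa>' * a e" for e
  proof -
    have I2: "qintegrable q \<gamma> (\<lambda>x. D e (q powi 1 * x))" by (rule qintegrable_scale[OF I])
    have I3: "qintegrable q \<gamma> (\<lambda>x. inverse q ^ n * D e (q powi 1 * x))" by (rule qintegrable_cmult[OF I2])
    have I4: "qintegrable q \<gamma> (\<lambda>x. \<kappa> * (D e x + inverse q ^ n * D e (q powi 1 * x)))"
      by (rule qintegrable_cmult[OF qintegrable_add[OF I I3]])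
    have I5: "qintegrable q \<gamma> (\<lambda>x. C * K ^ Suc e * U x)" by (rule qintegrable_cmult[OF U])
    have "a (Suc e) \<le> qint q \<gamma> (bd e)"
      unfolding a_def by (rule qint_mono[OF I _ step]) (unfold bd_def, rule qintegrable_add[OF I5 I4])
    also have "\<dots> = C * K ^ Suc e * QU + \<kappa> * (a e + inverse q ^ n * (inverse q * a e))"
      unfolding bd_def qint_add[OF I5 I4] qint_cmult qint_add[OF I I3] qint_scale
      by (simp add: QU_def a_def power_int_minus)
    also have "\<dots> = C * K ^ Suc e * QU + \<kappa>' * a e" by (simp add: \<kappa>'_def algebra_simps)
    finally show ?thesis .
  qed
  define M where "M = a 0 + C * QU"
  have M: "M \<ge> 0" "C * QU \<le> M" "a 0 \<le> M" using a0 C QU by (auto simp: M_def)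
  \<comment> \<open>The base \<open>K + \<kappa>'\<close> is chosen so that the induction closes:
    the inhomogeneous term is at most K times the bound for e, and the other term is \<kappa>' times
    that bound.\<close>
  have bound: "a e \<le> M * (K + \<kappa>') ^ e" for e
  proof (induction e)
    case 0
    show ?case using M by simp
  next
    case (Suc e)
    have "C * K ^ Suc e * QU = K * ((C * QU) * K ^ e)" by simp
    also have "\<dots> \<le> K * (M * (K + \<kappa>') ^ e)"
      using K \<kappa>' M C QU by (intro mult_left_mono mult_mono power_mono) auto
    finally have "C * K ^ Suc e * QU \<le> K * (M * (K + \<kappa>') ^ e)" .
    moreover have "\<kappa>' * a e \<le> \<kappa>' * (M * (K + \<kappa>') ^ e)" using Suc \<kappa>' by (rule mult_left_mono)
    ultimately show ?case using rec[of e] by (simp add: algebra_simps)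
  qed
  show thesis
  proof (rule that[of M "K + \<kappa>'"])
    show "qintegrable q \<gamma> (\<lambda>x. (qderiv q ^^ e) f x * of_real x ^ n)" for e
      using I[of e] unfolding D_def by (simp only: qintegrable_norm_iff)
    show "qint q \<gamma> (\<lambda>x. cmod ((qderiv q ^^ e) f x * of_real x ^ n)) \<le> M * (K + \<kappa>') ^ e" for e
      using bound[of e] by (simp add: a_def D_def)
  qed (use M K \<kappa>' in auto)
qed

lemma HS_qderiv_integrable:
  assumes "f \<in> HS_space q \<gamma> \<alpha>"
  shows "qintegrable q \<gamma> (\<lambda>x. (qderiv q ^^ e) f x * of_real x ^ n)"
  using HS_qderiv_bound[OF assms, of n] by metis

text \<open>The iterated q-derivative \<open>(qderiv q ^^ e) f\<close> approaches the same limit at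
  0 along both half lines, so the boundary terms of the next q-derivative cancel.\<close>

lemma qmoment_0_qderiv:
  assumes f: "f \<in> HS_space q \<gamma> \<alpha>"
  shows "qmoment q \<gamma> 0 ((qderiv q ^^ Suc e) f) = 0"
proof -
  obtain C K r where r: "r > 0"
    and lim: "\<And>e. \<exists>l M. \<forall>x\<in>L. \<bar>x\<bar> \<le> r \<longrightarrow> cmod ((qderiv q ^^ e) f x - l) \<le> M * \<bar>x\<bar>"
    using HS_near_zero[OF f] by metis
  obtain l M where l: "\<And>x. x \<in> L \<Longrightarrow> \<bar>x\<bar> \<le> r \<Longrightarrow> cmod ((qderiv q ^^ e) f x - l) \<le> M * \<bar>x\<bar>"
    using lim by metis
  have q0: "(\<lambda>N. q ^ N * \<gamma>) \<longlonglongrightarrow> 0"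
    using q_pos q_less_1 by (intro tendsto_mult_left_zero LIMSEQ_power_zero) simp
  have tend: "(\<lambda>N. (qderiv q ^^ e) f (\<epsilon> * (q ^ N * \<gamma>))) \<longlonglongrightarrow> l" if e: "\<epsilon> \<in> {1, -1}" for \<epsilon>
  proof (rule LIM_zero_cancel, rule Lim_null_comparison)
    show "(\<lambda>N. M * (q ^ N * \<gamma>)) \<longlonglongrightarrow> 0" using q0 by (rule tendsto_mult_right_zero)
    have "\<forall>\<^sub>F N in sequentially. q ^ N * \<gamma> < r" using q0 r by (rule order_tendstoD)
    then show "\<forall>\<^sub>F N in sequentially. cmod ((qderiv q ^^ e) f (\<epsilon> * (q ^ N * \<gamma>)) - l) \<le> M * (q ^ N * \<gamma>)"
    proof eventually_elim
      case (elim N)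
      have "\<epsilon> * (q ^ N * \<gamma>) \<in> L" using qpower_gamma_in_L[of "int N"] e by auto
      moreover have "\<bar>\<epsilon> * (q ^ N * \<gamma>)\<bar> = q ^ N * \<gamma>" using e q_pos gamma_pos by auto
      ultimately show ?case using l[of "\<epsilon> * (q ^ N * \<gamma>)"] elim by simp
    qed
  qed
  have "qint q \<gamma> (qderiv q ((qderiv q ^^ e) f)) = 0"
    using HS_qderiv_integrable[OF f, of e 0] HS_qderiv_integrable[OF f, of "Suc e" 0] tend[of 1] tend[of "-1"]
    by (intro qint_qderiv_eq_0) auto
  then show ?thesis by (simp add: qmoment_def)
qed

text \<open>The power \<open>x^(n+1)\<close> cancels the denominator of the q-derivative, so for
  positive index a dilation of the integral suffices and no boundary term appears. The dilation
  yields \<open>1 - q^(-(n+1))\<close>. Passing from n to n + 1 the normalising factor of the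
  moments gains \<open>q^(n+1)\<close>, which turns this into \<open>-(1 - q^(n+1))\<close>, that
  is, into a q-bracket.\<close>

lemma qmoment_Suc_qderiv:
  assumes u: "qintegrable q \<gamma> (\<lambda>x. u x * of_real x ^ n)"
  shows "qmoment q \<gamma> (Suc n) (qderiv q u) = - of_real (qbracket q (Suc n)) * qmoment q \<gamma> n u"
proof -
  define v where "v = (\<lambda>x. u x * of_real x ^ n)"
  have v: "qintegrable q \<gamma> v" using u by (simp add: v_def)
  have v': "qintegrable q \<gamma> (\<lambda>x. of_real (inverse q ^ n) * v (q powi 1 * x))"
    by (rule qintegrable_cmult[OF qintegrable_scale[OF v]])
  have "qint q \<gamma> (\<lambda>x. qderiv q u x * of_real x ^ Suc n)
      = qint q \<gamma> (\<lambda>x. of_real (1 / (1 - q)) * (v x - of_real (inverse q ^ n) * v (q powi 1 * x)))"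
  proof (rule qint_cong)
    fix x assume "x \<in> L"
    then have "x \<noteq> 0" by (rule L_nonzero)
    then show "qderiv q u x * of_real x ^ Suc n
        = of_real (1 / (1 - q)) * (v x - of_real (inverse q ^ n) * v (q powi 1 * x))"
      using q_pos q_less_1 by (simp add: qderiv_def v_def field_simps)
  qed
  also have "\<dots> = of_real (1 / (1 - q)) * (qint q \<gamma> v - of_real (inverse q ^ n) * (of_real (q powi (-1)) * qint q \<gamma> v))"
    by (simp only: qint_cmult qint_diff[OF v v'] qint_scale)
  also have "\<dots> = of_real ((1 - inverse q ^ Suc n) / (1 - q)) * qint q \<gamma> v"
    by (simp add: power_int_minus field_simps)
  finally have A: "qint q \<gamma> (\<lambda>x. qderiv q u x * of_real x ^ Suc n) = of_real ((1 - inverse q ^ Suc n) / (1 - q)) * qint q \<gamma> v" .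
  have "((Suc n)\<^sup>2 + Suc n) div 2 = (n\<^sup>2 + n) div 2 + Suc n"
    by (simp add: power2_eq_square algebra_simps)
  then have E: "q ^ (((Suc n)\<^sup>2 + Suc n) div 2) * ((1 - inverse q ^ Suc n) / (1 - q))
      = q ^ ((n\<^sup>2 + n) div 2) * (q ^ Suc n * (1 - inverse q ^ Suc n) / (1 - q))"
    by (simp only: power_add) simp
  have "q ^ Suc n * inverse q ^ Suc n = 1"
    using q_pos by (simp del: power_Suc flip: power_mult_distrib)
  then have C: "q ^ Suc n * (1 - inverse q ^ Suc n) = - (1 - q ^ Suc n)"
    by (simp only: right_diff_distrib mult_1_right minus_diff_eq)
  then have B: "q ^ (((Suc n)\<^sup>2 + Suc n) div 2) * ((1 - inverse q ^ Suc n) / (1 - q))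
      = - qbracket q (Suc n) * q ^ ((n\<^sup>2 + n) div 2)"
    unfolding E C qbracket_def by (simp only: mult_minus_left mult_minus_right divide_inverse mult_ac)
  show ?thesis
    unfolding qmoment_def A mult.assoc[symmetric] of_real_mult[symmetric] B v_def by simp
qed

section \<open>Moments of iterated q-derivatives and of convolutions\<close>

lemma qbracket_ge_1: "n \<ge> 1 \<Longrightarrow> qbracket q n \<ge> 1"
  using power_decreasing[of 1 n q] q_pos q_less_1 by (simp add: qbracket_def)

lemma qfact_ge_1: "qfact q n \<ge> 1"
  unfolding qfact_def using qbracket_ge_1 by (intro prod_ge_1) auto

lemma qfact_Suc: "qfact q (Suc n) = qbracket q (Suc n) * qfact q n"
  by (simp add: qfact_def mult.commute)

text \<open>Each q-derivative lowers the index by one and contributes a bracket; for e > n index 0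
  is reached while a q-derivative is still left, and its integral vanishes.\<close>

lemma qmoment_qderiv:
  assumes f: "f \<in> HS_space q \<gamma> \<alpha>"
  shows "qmoment q \<gamma> n ((qderiv q ^^ e) f) =
    (if e \<le> n then (-1) ^ e * of_real (qfact q n / qfact q (n - e)) * qmoment q \<gamma> (n - e) f else 0)"
proof (induction e arbitrary: n)
  case 0
  then show ?case using qfact_ge_1[of n] by simp
next
  case (Suc e)
  show ?case
  proof (cases n)
    case 0
    then show ?thesis using qmoment_0_qderiv[OF f, of e] by simp
  next
    case (Suc m)
    have "qmoment q \<gamma> n ((qderiv q ^^ Suc e) f)
        = - of_real (qbracket q (Suc m)) * qmoment q \<gamma> m ((qderiv q ^^ e) f)"
      using qmoment_Suc_qderiv[OF HS_qderiv_integrable[OF f], of m e] Suc by simp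
    then show ?thesis using Suc by (simp add: Suc.IH qfact_Suc)
  qed
qed

text \<open>The e-th term is the e-th power of \<open>(q powr (\<alpha> / 2)) ^ e * B\<close>, and
  this base tends to 0. Hence any exponential factor is absorbed.\<close>

lemma summable_gaussian:
  assumes "\<alpha> > 0" "B \<ge> 0"
  shows "summable (\<lambda>e::nat. q powr (\<alpha> * (real e)\<^sup>2 / 2) * B ^ e)"
proof (rule summable_comparison_test_ev)
  show "summable (\<lambda>e::nat. (1 / 2 :: real) ^ e)" by (rule summable_geometric) simp
  have "(\<lambda>e::nat. (q powr (\<alpha> / 2)) ^ e * B) \<longlonglongrightarrow> 0"
    using q_pos q_less_1 assms by (intro tendsto_mult_left_zero LIMSEQ_power_zero) (use powr_less_mono2[of "\<alpha> / 2" q 1] in simp)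
  then have "\<forall>\<^sub>F e in sequentially. (q powr (\<alpha> / 2)) ^ e * B < 1 / 2" by (rule order_tendstoD) simp
  then show "\<forall>\<^sub>F e in sequentially. norm (q powr (\<alpha> * (real e)\<^sup>2 / 2) * B ^ e) \<le> (1 / 2) ^ e"
  proof eventually_elim
    case (elim e)
    have "q powr (\<alpha> * (real e)\<^sup>2 / 2) * B ^ e = ((q powr (\<alpha> / 2)) ^ e * B) ^ e"
      using q_pos by (simp add: powr_power power_mult_distrib power2_eq_square mult_ac)
    moreover have "\<dots> \<le> (1 / 2) ^ e"
      using elim assms by (intro power_mono) auto
    ultimately show ?case using assms by simp
  qed
qed

text \<open>The sum is finite because the n-th moment of an e-fold q-derivative is 0 for e > n. The
  signs \<open>(-1)^e\<close> in the convolution cancel those of \<open>qmoment_qderiv\<close>,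
  which makes the formula symmetric.\<close>

lemma qmoment_convolution:
  assumes f: "f \<in> HS_space q \<gamma> \<alpha>" and g: "g \<in> HS_space q \<gamma> \<alpha>" and "\<alpha> > 0"
    and h: "eq_on_L q \<gamma> h (qconv q \<gamma> f g)"
  shows "qmoment q \<gamma> n h = (\<Sum>e\<le>n. of_real (qfact q n / (qfact q e * qfact q (n - e)))
           * qmoment q \<gamma> e f * qmoment q \<gamma> (n - e) g)"
proof -
  obtain M K where MK: "M \<ge> 0" "K \<ge> 0"
    and I: "\<And>e. qintegrable q \<gamma> (\<lambda>x. (qderiv q ^^ e) g x * of_real x ^ n)"
    and bd: "\<And>e. qint q \<gamma> (\<lambda>x. cmod ((qderiv q ^^ e) g x * of_real x ^ n)) \<le> M * K ^ e"
    using HS_qderiv_bound[OF g, of n] by metis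
  obtain C B where CB: "C > 0" "B > 0"
    "\<And>e. abs_qmoment q \<gamma> e f \<le> C * (q powr (\<alpha> * (real e)\<^sup>2 / 2) * B ^ e)"
    using HS_bound[OF f] by metis
  define m where "m = (\<lambda>e. (-1) ^ e * qmoment q \<gamma> e f / of_real (qfact q e))"
  define T where "T = (\<lambda>e x. m e * ((qderiv q ^^ e) g x * of_real x ^ n))"
  \<comment> \<open>Only \<open>qfact q e \<ge> 1\<close> is used for the denominator; the decay
    comes from the moments.\<close>
  have m: "cmod (m e) \<le> C * (q powr (\<alpha> * (real e)\<^sup>2 / 2) * B ^ e)" for e
  proof -
    have "cmod (m e) = cmod (qmoment q \<gamma> e f) / qfact q e"
      using qfact_ge_1[of e] by (simp add: m_def norm_mult norm_divide norm_power)
    also have "\<dots> \<le> cmod (qmoment q \<gamma> e f)"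
      using qfact_ge_1[of e] mult_left_mono[of 1 "qfact q e" "cmod (qmoment q \<gamma> e f)"]
      by (simp add: divide_le_eq)
    finally show ?thesis using norm_qmoment_le[OF f, of e] CB(3)[of e] by linarith
  qed
  have TI: "qintegrable q \<gamma> (T e)" for e unfolding T_def by (rule qintegrable_cmult[OF I])
  have "summable (\<lambda>e. qint q \<gamma> (\<lambda>x. norm (T e x)))"
  proof (rule summable_comparison_test')
    show "summable (\<lambda>e::nat. C * M * (q powr (\<alpha> * (real e)\<^sup>2 / 2) * (B * K) ^ e))"
      using CB MK \<open>\<alpha> > 0\<close> by (intro summable_mult summable_gaussian) auto
    fix e :: nat
    have "qint q \<gamma> (\<lambda>x. norm (T e x)) = cmod (m e) * qint q \<gamma> (\<lambda>x. cmod ((qderiv q ^^ e) g x * of_real x ^ n))"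
      unfolding T_def norm_mult[of "m e"] by (rule qint_cmult)
    also have "\<dots> \<le> (C * (q powr (\<alpha> * (real e)\<^sup>2 / 2) * B ^ e)) * (M * K ^ e)"
      using m CB q_pos by (intro mult_mono bd qint_nonneg) auto
    finally have "qint q \<gamma> (\<lambda>x. norm (T e x)) \<le> C * M * (q powr (\<alpha> * (real e)\<^sup>2 / 2) * (B * K) ^ e)"
      by (simp add: power_mult_distrib mult_ac)
    moreover have "qint q \<gamma> (\<lambda>x. norm (T e x)) \<ge> 0" by (rule qint_nonneg) simp
    ultimately show "norm (qint q \<gamma> (\<lambda>x. norm (T e x))) \<le> C * M * (q powr (\<alpha> * (real e)\<^sup>2 / 2) * (B * K) ^ e)"
      by simp
  qed
  note sums = qint_suminf[OF TI this] and pw = summable_norm_on_L[OF TI this]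
  have "qint q \<gamma> (\<lambda>x. h x * of_real x ^ n) = qint q \<gamma> (\<lambda>x. \<Sum>e. T e x)"
  proof (rule qint_cong)
    fix x assume x: "x \<in> L"
    have "(\<lambda>e. T e x / of_real x ^ n) sums ((\<Sum>e. T e x) / of_real x ^ n)"
      by (intro sums_divide summable_sums summable_norm_cancel[OF pw[OF x]])
    moreover have "(\<lambda>e. T e x / of_real x ^ n) = qconv_term q \<gamma> f g x"
      using L_nonzero[OF x] by (auto simp: T_def m_def qconv_term_def)
    ultimately have "h x = (\<Sum>e. T e x) / of_real x ^ n"
      using h x by (simp add: eq_on_L_def qconv_def sums_iff)
    then show "h x * of_real x ^ n = (\<Sum>e. T e x)" using L_nonzero[OF x] by simp
  qed
  then have "(\<lambda>e. of_real (q ^ ((n\<^sup>2 + n) div 2)) * qint q \<gamma> (T e)) sums qmoment q \<gamma> n h"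
    unfolding qmoment_def using sums by (simp only: sums_mult)
  also have "(\<lambda>e. of_real (q ^ ((n\<^sup>2 + n) div 2)) * qint q \<gamma> (T e)) = (\<lambda>e. m e * qmoment q \<gamma> n ((qderiv q ^^ e) g))"
    unfolding T_def qint_cmult qmoment_def by (simp add: mult_ac)
  also have "(\<lambda>e. m e * qmoment q \<gamma> n ((qderiv q ^^ e) g)) = (\<lambda>e. if e \<in> {..n} then of_real (qfact q n / (qfact q e * qfact q (n - e)))
           * qmoment q \<gamma> e f * qmoment q \<gamma> (n - e) g else 0)"
    by (auto simp: fun_eq_iff qmoment_qderiv[OF g] m_def field_simps simp flip: power_add)
  finally have "(\<lambda>e. if e \<in> {..n} then of_real (qfact q n / (qfact q e * qfact q (n - e)))
           * qmoment q \<gamma> e f * qmoment q \<gamma> (n - e) g else 0) sums qmoment q \<gamma> n h" .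
  moreover have "(\<lambda>e. if e \<in> {..n} then of_real (qfact q n / (qfact q e * qfact q (n - e)))
           * qmoment q \<gamma> e f * qmoment q \<gamma> (n - e) g else 0) sums (\<Sum>e\<in>{..n}. of_real (qfact q n / (qfact q e * qfact q (n - e)))
           * qmoment q \<gamma> e f * qmoment q \<gamma> (n - e) g)"
    by (rule sums_If_finite_set) simp
  ultimately show ?thesis by (rule sums_unique2)
qed

text \<open>\<open>is_HS_product\<close> places both products in the space, so determinacy applies
  to them as soon as their moments agree.\<close>

lemma commutative_if_moment_determined:
  assumes "HS_moment_determined q \<gamma> \<alpha>" "\<alpha> > 0"
  shows "HS_commutative q \<gamma> \<alpha>"
  unfolding HS_commutative_def
proof (intro ballI allI impI)
  fix f g h h' assume f: "f \<in> HS_space q \<gamma> \<alpha>" and g: "g \<in> HS_space q \<gamma> \<alpha>"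
    and h: "is_HS_product q \<gamma> \<alpha> f g h" and h': "is_HS_product q \<gamma> \<alpha> g f h'"
  have "qmoment q \<gamma> n h = qmoment q \<gamma> n h'" for n
  proof -
    have "qmoment q \<gamma> n h = (\<Sum>e\<le>n. of_real (qfact q n / (qfact q e * qfact q (n - e)))
           * qmoment q \<gamma> e f * qmoment q \<gamma> (n - e) g)"
      using qmoment_convolution[OF f g \<open>\<alpha> > 0\<close>] h by (simp add: is_HS_product_def)
    also have "\<dots> = (\<Sum>e\<le>n. of_real (qfact q n / (qfact q e * qfact q (n - e)))
           * qmoment q \<gamma> e g * qmoment q \<gamma> (n - e) f)"
      by (rule sum.reindex_bij_witness[of _ "\<lambda>e. n - e" "\<lambda>e. n - e"]) (auto simp: mult_ac)
    also have "\<dots> = qmoment q \<gamma> n h'"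
      using qmoment_convolution[OF g f \<open>\<alpha> > 0\<close>] h' by (simp add: is_HS_product_def)
    finally show ?thesis .
  qed
  then show "eq_on_L q \<gamma> h h'"
    using assms(1) h h' by (simp add: HS_moment_determined_def is_HS_product_def)
qed

subsection \<open>Determinacy for $\alpha > 1/2$\<close>

lemma power_int_q_inj: "q powi k = q powi l \<Longrightarrow> k = l"
proof (rule ccontr)
  have "q powi b < q powi a" if "a < b" for a b :: int
    using that q_pos q_less_1 by (rule power_int_strict_decreasing)
  moreover assume "q powi k = q powi l" "k \<noteq> l"
  ultimately show False by (metis less_irrefl linorder_neqE)
qed

lemma inj_on_pt: "inj_on pt J"
proof (rule inj_onI)
  fix i j assume ij: "i \<in> J" "j \<in> J" "pt i = pt j"
  then have "q powi fst i * \<gamma> = q powi fst j * \<gamma>" by (metis abs_pt)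
  then have "fst i = fst j" using gamma_pos by (auto intro: power_int_q_inj)
  moreover have "snd i = snd j" using ij \<open>fst i = fst j\<close> gamma_pos q_pos by (auto simp: pt_def)
  ultimately show "i = j" by (rule prod_eqI)
qed

lemma qint_single:
  fixes v :: "'a :: banach"
  assumes "x0 \<in> L"
  shows "qint q \<gamma> (\<lambda>x. if x = x0 then v else 0) = ((1 - q) * \<bar>x0\<bar>) *\<^sub>R v"
proof -
  obtain i where i: "i \<in> J" "x0 = pt i" using assms by (auto simp: L_eq_pt_image)
  have "infsum (\<lambda>j. \<bar>pt j\<bar> *\<^sub>R (if pt j = x0 then v else 0)) J = infsum (\<lambda>j. \<bar>pt j\<bar> *\<^sub>R (if pt j = x0 then v else 0)) {i}"
    using i inj_on_pt by (intro infsum_cong_neutral) (auto simp: inj_on_def)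
  then show ?thesis using i by (simp add: qint_eq)
qed

lemma L_ratio:
  assumes "x \<in> L" "y \<in> L"
  obtains k \<epsilon> where "\<epsilon> \<in> {1, -1}" "x = \<epsilon> * q powi k * y"
proof -
  obtain a b \<delta> \<eta> where "x = \<delta> * (q powi a * \<gamma>)" "y = \<eta> * (q powi b * \<gamma>)" "\<delta> \<in> {1, -1}" "\<eta> \<in> {1, -1}"
    using assms unfolding qlattice_def by blast
  then have "x = (\<delta> * \<eta>) * q powi (a - b) * y" "\<delta> * \<eta> \<in> {1, -1}"
    using q_pos by (auto simp: power_int_diff)
  then show thesis using that by blast
qed

text \<open>Keeps the denominators of \<open>lagrange\<close> away from 0 uniformly in the number of
  factors. With \<open>s = 1 / (1 - q^2)\<close> every factor satisfies
  \<open>1 - a \<ge> exp (- s * a)\<close>, and the numbers \<open>a = q^(2k)\<close> have sum at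
  most s; so \<open>exp (- s * s)\<close> serves as the bound.\<close>

lemma q_pochhammer_lower_bound:
  obtains c where "c > 0" "\<And>n. c \<le> (\<Prod>k=1..n. 1 - q ^ (2 * k))"
proof -
  define s where "s = 1 / (1 - q\<^sup>2)"
  have q2: "q\<^sup>2 < 1" "0 < q\<^sup>2" using q_pos q_less_1 by (auto simp: power_less_one_iff)
  then have s: "s > 0" by (simp add: s_def)
  have "exp (- s * s) \<le> (\<Prod>k=1..n. 1 - q ^ (2 * k))" for n
  proof -
    have 1: "exp (- s * q ^ (2 * k)) \<le> 1 - q ^ (2 * k)" if "k \<ge> 1" for k
    proof -
      define a where "a = q ^ (2 * k)"
      have a: "0 < a" "a \<le> q\<^sup>2"
        using that q_pos q_less_1 power_decreasing[of 2 "2 * k" q] by (auto simp: a_def)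
      have "a / (1 - a) \<le> s * a"
        using a q2 unfolding s_def by (simp add: divide_left_mono frac_le)
      then have "1 + a / (1 - a) \<le> exp (s * a)"
        using exp_ge_add_one_self[of "s * a"] by linarith
      moreover have "1 + a / (1 - a) = 1 / (1 - a)" using a q2 by (simp add: field_simps)
      ultimately have "1 / (1 - a) \<le> exp (s * a)" by simp
      then have "1 / exp (s * a) \<le> 1 - a" using a q2 by (simp add: field_simps)
      then show ?thesis by (simp add: a_def exp_minus field_simps)
    qed
    have "(\<Sum>k=1..n. q ^ (2 * k)) \<le> s"
    proof -
      have "(\<Sum>k=1..n. q ^ (2 * k)) = (\<Sum>k\<in>{1..n}. (q\<^sup>2) ^ k)"
        by (simp add: power_mult)
      also have "\<dots> \<le> (\<Sum>k<Suc n. (q\<^sup>2) ^ k)"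
        using q_pos by (intro sum_mono2) auto
      also have "\<dots> \<le> (\<Sum>k. (q\<^sup>2) ^ k)"
        using q2 by (intro sum_le_suminf summable_geometric) auto
      also have "\<dots> = s" using q2 by (simp add: suminf_geometric s_def)
      finally show ?thesis .
    qed
    then have "exp (- s * s) \<le> exp (- s * (\<Sum>k=1..n. q ^ (2 * k)))" using s by simp
    also have "\<dots> = (\<Prod>k=1..n. exp (- s * q ^ (2 * k)))"
      by (simp add: sum_distrib_left exp_sum flip: sum_negf)
    also have "\<dots> \<le> (\<Prod>k=1..n. 1 - q ^ (2 * k))"
      using 1 by (intro prod_mono) auto
    finally show ?thesis .
  qed
  then show thesis using that[of "exp (- s * s)"] by simp
qed

text \<open>An interpolation polynomial in the ratio \<open>t = x / x0\<close>, normalised to 1 at t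
  = 1. \<open>M\<close> counts the zeros towards 0 and \<open>N\<close> those towards infinity. The
  linear factor removes t = -1, which a polynomial in \<open>t^2\<close> cannot separate from t =
  1.\<close>

definition lagrange :: "nat \<Rightarrow> nat \<Rightarrow> real \<Rightarrow> real" where
  "lagrange M N t = (1 + t) / 2 * (\<Prod>k=1..M. (t\<^sup>2 - q ^ (2 * k)) / (1 - q ^ (2 * k)))
     * (\<Prod>k=1..N. (1 - t\<^sup>2 * q ^ (2 * k)) / (1 - q ^ (2 * k)))"

lemma q_even_power_bounds: "k \<ge> 1 \<Longrightarrow> 0 < q ^ (2 * k) \<and> q ^ (2 * k) < 1"
  using q_pos q_less_1 by (simp add: power_less_one_iff)

lemma lagrange_1: "lagrange M N 1 = 1"
  unfolding lagrange_def using q_even_power_bounds by (auto simp: less_imp_neq[symmetric] intro!: prod.neutral)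

text \<open>Away from t = 1 and from the zeros, t lies beyond one of the two ends. The two terms are
  the bounds at the inner and at the outer end; they are added so that one inequality holds on the
  whole lattice.\<close>

lemma lagrange_bound:
  assumes c: "c > 0" "\<And>n. c \<le> (\<Prod>k=1..n. 1 - q ^ (2 * k))"
    and t: "\<bar>t\<bar> = q powi m" "t \<noteq> 1"
  shows "\<bar>lagrange M N t\<bar> \<le> (q ^ M + q ^ (N * Suc N) * \<bar>t\<bar> ^ (2 * N + 2 * M + 1)) / c\<^sup>2"
proof -
  have t2: "t\<^sup>2 = q powi (2 * m)"
    using t(1) by (metis power2_abs power_int_mult power_int_numeral mult.commute)
  have rhs: "0 \<le> (q ^ M + q ^ (N * Suc N) * \<bar>t\<bar> ^ (2 * N + 2 * M + 1)) / c\<^sup>2"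
    using q_pos by simp
  define w where "w = (\<lambda>n. \<Prod>k=1..n. 1 - q ^ (2 * k))"
  have w: "c \<le> w n" "w n > 0" for n using c(2)[of n] c(1) by (auto simp: w_def intro: less_le_trans)
  have wabs: "(\<Prod>k=1..n. \<bar>1 - q ^ (2 * k)\<bar>) = w n" for n
    unfolding w_def using q_even_power_bounds by (intro prod.cong) (auto simp: less_imp_le)
  have eq: "\<bar>lagrange M N t\<bar> = \<bar>1 + t\<bar> / 2 * (\<Prod>k=1..M. \<bar>t\<^sup>2 - q ^ (2 * k)\<bar>) * (\<Prod>k=1..N. \<bar>1 - t\<^sup>2 * q ^ (2 * k)\<bar>) / (w M * w N)"
    by (simp add: lagrange_def abs_mult prod_dividef abs_prod wabs[simplified])
  have fin: "\<bar>lagrange M N t\<bar> \<le> X / c\<^sup>2"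
    if "\<bar>1 + t\<bar> / 2 * (\<Prod>k=1..M. \<bar>t\<^sup>2 - q ^ (2 * k)\<bar>) * (\<Prod>k=1..N. \<bar>1 - t\<^sup>2 * q ^ (2 * k)\<bar>) \<le> X" for X
  proof -
    have "0 \<le> \<bar>1 + t\<bar> / 2 * (\<Prod>k=1..M. \<bar>t\<^sup>2 - q ^ (2 * k)\<bar>) * (\<Prod>k=1..N. \<bar>1 - t\<^sup>2 * q ^ (2 * k)\<bar>)"
      by (intro mult_nonneg_nonneg prod_nonneg) auto
    moreover have "c\<^sup>2 \<le> w M * w N"
      unfolding power2_eq_square using w(1)[of M] w(1)[of N] c(1) by (intro mult_mono) auto
    ultimately show ?thesis
      unfolding eq using that c(1) by (intro frac_le) auto
  qed
  have neg: "\<bar>t\<bar> = 1 / q ^ n" "t\<^sup>2 = 1 / q ^ (2 * n)" if "m = - int n" for n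
  proof -
    show "\<bar>t\<bar> = 1 / q ^ n" using t(1) that by (simp add: power_int_minus inverse_eq_divide)
    then have "\<bar>t\<bar>\<^sup>2 = 1 / q ^ (2 * n)" by (simp add: power_divide power_mult mult.commute flip: power_mult)
    then show "t\<^sup>2 = 1 / q ^ (2 * n)" by simp
  qed
  \<comment> \<open>Since t = 1 is excluded, \<open>m = 0\<close> leaves only t = -1. The second and
    fourth cases are zeros of the two products; the third and fifth are the inner and the outer
    end.\<close>
  consider "m = 0" | "m \<ge> 1" "m \<le> int M" | "m > int M" | "m \<le> -1" "m \<ge> - int N" | "m < - int N" by linarith
  then show ?thesis
  proof cases
    case 1
    then have "t = -1" using t by auto
    then show ?thesis using rhs by (simp add: lagrange_def)
  next
    case 2
    then have "t\<^sup>2 - q ^ (2 * nat m) = 0" unfolding t2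
      by (simp add: power_int_def nat_mult_distrib)
    then have "(\<Prod>k=1..M. (t\<^sup>2 - q ^ (2 * k)) / (1 - q ^ (2 * k))) = 0"
      using 2 by (intro prod_zero bexI[of _ "nat m"]) auto
    then have "lagrange M N t = 0" unfolding lagrange_def by (simp only: mult_zero_left mult_zero_right)
    then show ?thesis using rhs by (simp only: abs_zero)
  next
    case 3
    then have m: "m = int (nat m)" "nat m > M" by auto
    have t1: "\<bar>t\<bar> < 1" using t(1) m q_pos q_less_1
      by (metis power_int_of_nat power_less_one_iff less_imp_le gr_zeroI not_less_zero)
    have le: "t\<^sup>2 \<le> q ^ (2 * k)" if "k \<le> M" for k
    proof -
      have "t\<^sup>2 = q ^ (2 * nat m)" unfolding t2 using 3 by (simp add: power_int_def nat_mult_distrib)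
      then show ?thesis using that m q_pos q_less_1 by (simp add: power_decreasing)
    qed
    \<comment> \<open>At the inner end each of the \<open>M\<close> factors is at most
      \<open>q^(2k) \<le> q\<close>. This crude bound is enough, since \<open>q^M\<close> still
      tends to 0.\<close>
    have "\<bar>1 + t\<bar> / 2 * (\<Prod>k=1..M. \<bar>t\<^sup>2 - q ^ (2 * k)\<bar>) * (\<Prod>k=1..N. \<bar>1 - t\<^sup>2 * q ^ (2 * k)\<bar>) \<le> 1 * (\<Prod>k=1..M. q) * (\<Prod>k=1..N. 1)"
    proof (intro mult_mono prod_mono conjI)
      fix k assume k: "k \<in> {1..M}"
      have "q ^ (2 * k) \<le> q ^ 1" using k q_pos q_less_1 by (intro power_decreasing) auto
      moreover have "t\<^sup>2 \<le> q ^ (2 * k)" using le k by simp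
      ultimately show "\<bar>t\<^sup>2 - q ^ (2 * k)\<bar> \<le> q"
        using zero_le_power2[of t] by (simp only: power_one_right)
    next
      fix k assume k: "k \<in> {1..N}"
      have "t\<^sup>2 \<le> 1" using t1 by (simp add: abs_square_le_1)
      moreover have "q ^ (2 * k) \<le> 1" using q_pos q_less_1 by (intro power_le_one) auto
      ultimately have "t\<^sup>2 * q ^ (2 * k) \<le> 1" using q_pos by (intro mult_le_one) auto
      then show "\<bar>1 - t\<^sup>2 * q ^ (2 * k)\<bar> \<le> 1" using q_pos by (simp add: abs_le_iff)
    qed (use t1 q_pos in \<open>auto intro!: prod_nonneg\<close>)
    then have "\<bar>lagrange M N t\<bar> \<le> q ^ M / c\<^sup>2" by (intro fin) simp
    also have "\<dots> \<le> (q ^ M + q ^ (N * Suc N) * \<bar>t\<bar> ^ (2 * N + 2 * M + 1)) / c\<^sup>2"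
      using q_pos by (intro divide_right_mono) auto
    finally show ?thesis .
  next
    case 4
    then have "1 - t\<^sup>2 * q ^ (2 * nat (-m)) = 0"
      using neg(2)[of "nat (-m)"] q_pos by simp
    then have "(\<Prod>k=1..N. (1 - t\<^sup>2 * q ^ (2 * k)) / (1 - q ^ (2 * k))) = 0"
      using 4 by (intro prod_zero bexI[of _ "nat (-m)"]) auto
    then have "lagrange M N t = 0" unfolding lagrange_def by (simp only: mult_zero_left mult_zero_right)
    then show ?thesis using rhs by (simp only: abs_zero)
  next
    case 5
    define n where "n = nat (- m)"
    have n: "m = - int n" "n > N" using 5 by (auto simp: n_def)
    note tn = neg(1)[OF n(1)]
    have t1: "\<bar>t\<bar> \<ge> 1" unfolding tn using q_pos q_less_1 by (simp add: power_le_one)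
    have tsq: "t\<^sup>2 \<ge> 1" using t1 by (simp add: abs_le_square_iff[of 1, simplified])
    \<comment> \<open>At the outer end every factor is replaced by its dominant monomial; the
      exponents 2 + 4 + ... + 2N then add up to \<open>N * Suc N\<close>.\<close>
    have "\<bar>1 + t\<bar> / 2 * (\<Prod>k=1..M. \<bar>t\<^sup>2 - q ^ (2 * k)\<bar>) * (\<Prod>k=1..N. \<bar>1 - t\<^sup>2 * q ^ (2 * k)\<bar>)
        \<le> \<bar>t\<bar> * (\<Prod>k=1..M. t\<^sup>2) * (\<Prod>k=1..N. t\<^sup>2 * q ^ (2 * k))"
    proof (intro mult_mono prod_mono conjI)
      fix k assume k: "k \<in> {1..M}"
      then show "\<bar>t\<^sup>2 - q ^ (2 * k)\<bar> \<le> t\<^sup>2" using q_even_power_bounds[of k] tsq by auto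
    next
      fix k assume k: "k \<in> {1..N}"
      have "q ^ (2 * n) \<le> q ^ (2 * k)" using k n q_pos q_less_1 by (intro power_decreasing) auto
      then have "1 \<le> t\<^sup>2 * q ^ (2 * k)" unfolding neg(2)[OF n(1)] using q_pos by (simp add: field_simps)
      then show "\<bar>1 - t\<^sup>2 * q ^ (2 * k)\<bar> \<le> t\<^sup>2 * q ^ (2 * k)" by simp
    qed (use t1 q_pos in \<open>auto intro!: prod_nonneg\<close>)
    also have "\<dots> = q ^ (N * Suc N) * \<bar>t\<bar> ^ (2 * N + 2 * M + 1)"
    proof -
      have "(\<Prod>k=1..N. q ^ (2 * k)) = q ^ (\<Sum>k=1..N. 2 * k)" by (simp add: power_sum)
      also have "(\<Sum>k=1..N. 2 * k) = N * Suc N" by (induction N) auto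
      finally show ?thesis by (simp add: prod.distrib power_add power_mult)
    qed
    finally have "\<bar>lagrange M N t\<bar> \<le> q ^ (N * Suc N) * \<bar>t\<bar> ^ (2 * N + 2 * M + 1) / c\<^sup>2" by (rule fin)
    also have "\<dots> \<le> (q ^ M + q ^ (N * Suc N) * \<bar>t\<bar> ^ (2 * N + 2 * M + 1)) / c\<^sup>2"
      using q_pos by (intro divide_right_mono) auto
    finally show ?thesis .
  qed
qed

text \<open>All multiples by powers of x are included so that the property is stable under
  multiplying \<open>p\<close> by polynomials. Test polynomials can then be built factor by factor
  without expanding them.\<close>

definition annihilates :: "(real \<Rightarrow> complex) \<Rightarrow> (real \<Rightarrow> real) \<Rightarrow> bool" where
  "annihilates f p \<longleftrightarrow> (\<forall>e. qintegrable q \<gamma> (\<lambda>x. f x * of_real (x ^ e * p x)) \<and>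
     qint q \<gamma> (\<lambda>x. f x * of_real (x ^ e * p x)) = 0)"

lemma annihilates_mult:
  assumes "annihilates f p"
  shows "annihilates f (\<lambda>x. (a + b * x ^ n) * p x)"
proof -
  have eq: "f x * of_real (x ^ e * ((a + b * x ^ n) * p x)) =
      of_real a * (f x * of_real (x ^ e * p x)) + of_real b * (f x * of_real (x ^ (e + n) * p x))" for e x
    by (simp add: algebra_simps power_add)
  have I: "qintegrable q \<gamma> (\<lambda>x. of_real c * (f x * of_real (x ^ e * p x)))" for c e
    using assms by (intro qintegrable_cmult) (simp add: annihilates_def)
  have Z: "qint q \<gamma> (\<lambda>x. of_real c * (f x * of_real (x ^ e * p x))) = 0" for c e
    using assms by (subst qint_cmult) (simp add: annihilates_def)
  show ?thesis
    unfolding annihilates_def eq using qintegrable_add[OF I I] qint_add[OF I I] Z by simp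
qed

lemma annihilates_prod:
  fixes N :: nat
  assumes "annihilates f p"
  shows "annihilates f (\<lambda>x. (\<Prod>k=1..N. a k + b k * x ^ n) * p x)"
proof (induction N)
  case (Suc N)
  from annihilates_mult[OF Suc, of "a (Suc N)" "b (Suc N)" n] show ?case
    by (simp add: mult_ac)
qed (use assms in simp)

lemma annihilates_lagrange:
  assumes "annihilates f (\<lambda>_. 1)" "x0 \<noteq> 0"
  shows "annihilates f (\<lambda>x. lagrange M N (x / x0))"
proof -
  \<comment> \<open>The coefficients that write each quadratic factor of
    \<open>lagrange M N (x / x0)\<close> as \<open>a + b * x^2\<close>, the form required by
    \<open>annihilates_prod\<close>.\<close>
  define A where "A = (\<lambda>k::nat. - (q ^ (2 * k)) / (1 - q ^ (2 * k)))"
  define B where "B = (\<lambda>k::nat. 1 / (x0\<^sup>2 * (1 - q ^ (2 * k))))"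
  define A' where "A' = (\<lambda>k::nat. 1 / (1 - q ^ (2 * k)))"
  define B' where "B' = (\<lambda>k::nat. - (q ^ (2 * k)) / (x0\<^sup>2 * (1 - q ^ (2 * k))))"
  have "annihilates f (\<lambda>x. (1 / 2 + 1 / (2 * x0) * x ^ 1) *
      ((\<Prod>k=1..M. A k + B k * x ^ 2) * ((\<Prod>k=1..N. A' k + B' k * x ^ 2) * 1)))"
    by (intro annihilates_mult annihilates_prod assms)
  also have "(\<lambda>x. (1 / 2 + 1 / (2 * x0) * x ^ 1) *
      ((\<Prod>k=1..M. A k + B k * x ^ 2) * ((\<Prod>k=1..N. A' k + B' k * x ^ 2) * 1))) = (\<lambda>x. lagrange M N (x / x0))"
  proof
    fix x
    have "A k + B k * x\<^sup>2 = ((x / x0)\<^sup>2 - q ^ (2 * k)) / (1 - q ^ (2 * k))" for k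
      using assms(2) by (simp add: A_def B_def power_divide diff_divide_distrib)
    moreover have "A' k + B' k * x\<^sup>2 = (1 - (x / x0)\<^sup>2 * q ^ (2 * k)) / (1 - q ^ (2 * k))" for k
      using assms(2) by (simp add: A'_def B'_def power_divide diff_divide_distrib mult_ac)
    moreover have "1 / 2 + 1 / (2 * x0) * x ^ 1 = (1 + x / x0) / 2"
      using assms(2) by (simp add: field_simps)
    ultimately show "(1 / 2 + 1 / (2 * x0) * x ^ 1) *
      ((\<Prod>k=1..M. A k + B k * x ^ 2) * ((\<Prod>k=1..N. A' k + B' k * x ^ 2) * 1)) = lagrange M N (x / x0)"
      by (simp only: lagrange_def mult.assoc mult_1_right)
  qed
  finally show ?thesis .
qed

text \<open>The integral of f against \<open>lagrange\<close> is 0, while \<open>lagrange\<close> is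
  1 at x0. The x0-term of the integral is thus minus the sum of all other terms, which
  \<open>lagrange_bound\<close> controls.\<close>

lemma vanishing_moments_estimate:
  assumes ann: "annihilates f (\<lambda>_. 1)" and x0: "x0 \<in> L"
    and c: "c > 0" "\<And>n. c \<le> (\<Prod>k=1..n. 1 - q ^ (2 * k))"
  shows "(1 - q) * \<bar>x0\<bar> * cmod (f x0) \<le> (q ^ M * qint q \<gamma> (\<lambda>x. cmod (f x)) +
    q ^ (N * Suc N) * qint q \<gamma> (\<lambda>x. cmod (f x * of_real x ^ (2 * N + 2 * M + 1))) / \<bar>x0\<bar> ^ (2 * N + 2 * M + 1)) / c\<^sup>2"
proof -
  have x00: "x0 \<noteq> 0" using L_nonzero[OF x0] .
  define d where "d = 2 * N + 2 * M + 1"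
  define G where "G = (\<lambda>x. f x * of_real (lagrange M N (x / x0)))"
  \<comment> \<open>Subtracting the one-point function removes the x0-term from \<open>G\<close>;
    the other lattice points have ratio t different from 1, as \<open>lagrange_bound\<close>
    requires.\<close>
  define G0 where "G0 = (\<lambda>x. if x = x0 then f x0 else 0)"
  define W where "W = (\<lambda>x. q ^ M / c\<^sup>2 * cmod (f x) + q ^ (N * Suc N) / (\<bar>x0\<bar> ^ d * c\<^sup>2) * cmod (f x * of_real x ^ d))"
  have fI: "qintegrable q \<gamma> (\<lambda>x. cmod (f x * of_real x ^ e))" for e
    using ann by (simp add: annihilates_def qintegrable_norm_iff)
  have GI: "qintegrable q \<gamma> G" and GZ: "qint q \<gamma> G = 0"
    using annihilates_lagrange[OF ann x00, of M N] unfolding annihilates_def G_def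
    by (auto dest!: spec[of _ 0])
  have G0I: "qintegrable q \<gamma> G0"
    by (rule qintegrable_bounded_support[of "\<bar>x0\<bar>" _ "cmod (f x0)"]) (auto simp: G0_def)
  have WI: "qintegrable q \<gamma> W"
    unfolding W_def using fI[of 0] fI[of d] by (intro qintegrable_add qintegrable_cmult) auto
  have "qint q \<gamma> (\<lambda>x. G0 x - G x) = ((1 - q) * \<bar>x0\<bar>) *\<^sub>R f x0"
    using qint_diff[OF G0I GI] GZ qint_single[OF x0, of "f x0"] by (simp add: G0_def)
  then have "(1 - q) * \<bar>x0\<bar> * cmod (f x0) = cmod (qint q \<gamma> (\<lambda>x. G0 x - G x))"
    using q_less_1 by (simp add: abs_mult)
  also have "\<dots> \<le> qint q \<gamma> (\<lambda>x. cmod (G0 x - G x))"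
    by (rule norm_qint_le[OF qintegrable_diff[OF G0I GI]])
  also have "\<dots> \<le> qint q \<gamma> W"
  proof (rule qint_mono)
    show "qintegrable q \<gamma> (\<lambda>x. cmod (G0 x - G x))"
      using qintegrable_diff[OF G0I GI] by (simp add: qintegrable_norm_iff)
    show "qintegrable q \<gamma> W" by (rule WI)
    fix x assume x: "x \<in> L"
    show "cmod (G0 x - G x) \<le> W x"
    proof (cases "x = x0")
      case True
      then have "G0 x - G x = 0" using x00 by (simp add: G0_def G_def lagrange_1)
      then show ?thesis using q_pos by (simp add: W_def)
    next
      case False
      obtain m \<epsilon> where m: "\<epsilon> \<in> {1, -1}" "x = \<epsilon> * q powi m * x0" by (rule L_ratio[OF x x0])
      have "\<bar>lagrange M N (x / x0)\<bar> \<le> (q ^ M + q ^ (N * Suc N) * \<bar>x / x0\<bar> ^ d) / c\<^sup>2"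
        unfolding d_def using False x00 m q_pos by (intro lagrange_bound[OF c, of _ m]) (auto simp: abs_mult)
      then have "cmod (f x) * \<bar>lagrange M N (x / x0)\<bar> \<le> cmod (f x) * ((q ^ M + q ^ (N * Suc N) * \<bar>x / x0\<bar> ^ d) / c\<^sup>2)"
        by (rule mult_left_mono) simp
      also have "\<dots> = W x"
        by (simp add: W_def norm_mult norm_power power_divide abs_divide add_divide_distrib distrib_left mult_ac)
      finally show ?thesis using False by (simp add: G0_def G_def norm_mult)
    qed
  qed
  also have "\<dots> = q ^ M / c\<^sup>2 * qint q \<gamma> (\<lambda>x. cmod (f x)) + q ^ (N * Suc N) / (\<bar>x0\<bar> ^ d * c\<^sup>2) * qint q \<gamma> (\<lambda>x. cmod (f x * of_real x ^ d))"
    unfolding W_def using fI[of 0] fI[of d]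
    by (subst qint_add) (auto simp only: qint_cmult power_0 of_real_1 mult_1_right intro!: qintegrable_cmult)
  finally show ?thesis by (simp add: d_def add_divide_distrib mult_ac)
qed

section \<open>Polynomial growth against moment decay\<close>

lemma HS_abs_integral_bound:
  assumes "f \<in> HS_space q \<gamma> \<alpha>"
  obtains C B where "C > 0" "B > 0"
    "\<And>e. qint q \<gamma> (\<lambda>x. cmod (f x * of_real x ^ e))
      \<le> C * q powr (\<alpha> * (real e)\<^sup>2 / 2 - ((real e)\<^sup>2 + real e) / 2) * B ^ e"
proof -
  obtain C B where CB: "C > 0" "B > 0"
    "\<And>e. abs_qmoment q \<gamma> e f \<le> C * (q powr (\<alpha> * (real e)\<^sup>2 / 2) * B ^ e)"
    using HS_bound[OF assms] by metis
  have "qint q \<gamma> (\<lambda>x. cmod (f x * of_real x ^ e))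
      \<le> C * q powr (\<alpha> * (real e)\<^sup>2 / 2 - ((real e)\<^sup>2 + real e) / 2) * B ^ e" for e
    using CB(3)[of e] q_pos
    unfolding abs_qmoment_def q_power_triangle powr_diff by (simp add: field_simps)
  then show thesis using that CB by blast
qed

lemma moment_determined_if_gt_half:
  assumes \<alpha>: "\<alpha> > 1 / 2"
  shows "HS_moment_determined q \<gamma> \<alpha>"
  unfolding HS_moment_determined_def eq_on_L_def
proof (intro ballI impI)
  fix f1 f2 x0
  assume f1: "f1 \<in> HS_space q \<gamma> \<alpha>" and f2: "f2 \<in> HS_space q \<gamma> \<alpha>"
    and eq: "\<forall>e. qmoment q \<gamma> e f1 = qmoment q \<gamma> e f2" and x0: "x0 \<in> L"
  define f where "f = (\<lambda>x. f1 x - f2 x)"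
  have x00: "\<bar>x0\<bar> > 0" using L_nonzero[OF x0] by simp
  note I1 = HS_integrable[OF f1] and I2 = HS_integrable[OF f2]
  have ann: "annihilates f (\<lambda>_. 1)"
  proof -
    have "qint q \<gamma> (\<lambda>x. f1 x * of_real x ^ e) = qint q \<gamma> (\<lambda>x. f2 x * of_real x ^ e)" for e
      using eq q_pos by (simp add: qmoment_def)
    then show ?thesis
      using qintegrable_diff[OF I1 I2] qint_diff[OF I1 I2]
      by (simp add: annihilates_def f_def left_diff_distrib)
  qed
  define S where "S = (\<lambda>e. qint q \<gamma> (\<lambda>x. cmod (f x * of_real x ^ e)))"
  obtain C B where C: "C > 0" and B: "B > 0" and
    S: "\<And>e. S e \<le> C * q powr (\<alpha> * (real e)\<^sup>2 / 2 - ((real e)\<^sup>2 + real e) / 2) * B ^ e"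
  proof -
    obtain C1 B1 where 1: "C1 > 0" "B1 > 0"
      "\<And>e. qint q \<gamma> (\<lambda>x. cmod (f1 x * of_real x ^ e)) \<le> C1 * q powr (\<alpha> * (real e)\<^sup>2 / 2 - ((real e)\<^sup>2 + real e) / 2) * B1 ^ e"
      by (rule HS_abs_integral_bound[OF f1]) (rule that)
    obtain C2 B2 where 2: "C2 > 0" "B2 > 0"
      "\<And>e. qint q \<gamma> (\<lambda>x. cmod (f2 x * of_real x ^ e)) \<le> C2 * q powr (\<alpha> * (real e)\<^sup>2 / 2 - ((real e)\<^sup>2 + real e) / 2) * B2 ^ e"
      by (rule HS_abs_integral_bound[OF f2]) (rule that)
    have "S e \<le> (C1 + C2) * q powr (\<alpha> * (real e)\<^sup>2 / 2 - ((real e)\<^sup>2 + real e) / 2) * max B1 B2 ^ e" for e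
    proof -
      let ?w = "q powr (\<alpha> * (real e)\<^sup>2 / 2 - ((real e)\<^sup>2 + real e) / 2)"
      have J1: "qintegrable q \<gamma> (\<lambda>x. cmod (f1 x * of_real x ^ e))" and J2: "qintegrable q \<gamma> (\<lambda>x. cmod (f2 x * of_real x ^ e))"
        using I1 I2 by (simp_all only: qintegrable_norm_iff)
      have "S e \<le> qint q \<gamma> (\<lambda>x. cmod (f1 x * of_real x ^ e) + cmod (f2 x * of_real x ^ e))"
        unfolding S_def
      proof (rule qint_mono[OF _ qintegrable_add[OF J1 J2]])
        show "qintegrable q \<gamma> (\<lambda>x. cmod (f x * of_real x ^ e))"
          using ann by (simp add: annihilates_def qintegrable_norm_iff)
      qed (simp add: f_def left_diff_distrib norm_triangle_ineq4)
      also have "\<dots> \<le> C1 * ?w * B1 ^ e + C2 * ?w * B2 ^ e"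
        unfolding qint_add[OF J1 J2] using 1(3)[of e] 2(3)[of e] by (rule add_mono)
      also have "\<dots> \<le> C1 * ?w * max B1 B2 ^ e + C2 * ?w * max B1 B2 ^ e"
        using 1 2 by (intro add_mono mult_left_mono power_mono) auto
      finally show ?thesis by (simp add: algebra_simps)
    qed
    then show thesis using that[of "C1 + C2" "max B1 B2"] 1 2 by auto
  qed
  obtain c where c: "c > 0" "\<And>n. c \<le> (\<Prod>k=1..n. 1 - q ^ (2 * k))"
    using q_pochhammer_lower_bound by metis
  have le_M: "(1 - q) * \<bar>x0\<bar> * cmod (f x0) \<le> q ^ M * S 0 / c\<^sup>2" for M
  proof -
    \<comment> \<open>The degree is 2N + m, and the exponent of q is sorted by powers of N:
      \<open>D\<close> collects the linear part and \<open>E\<close> the constant part, while the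
      quadratic part is \<open>(2\<alpha> - 1) N^2\<close>. Both \<open>D\<close> and
      \<open>E\<close> depend on M, so N must tend to infinity first, with M fixed.\<close>
    define m where "m = real (2 * M + 1)"
    define D where "D = q powr (2 * (\<alpha> - 1) * m) * (B / \<bar>x0\<bar>)\<^sup>2"
    define E where "E = C * q powr ((\<alpha> - 1) * m\<^sup>2 / 2 - m / 2) * (B / \<bar>x0\<bar>) ^ (2 * M + 1)"
    have bd: "q ^ (N * Suc N) * S (2 * N + 2 * M + 1) / \<bar>x0\<bar> ^ (2 * N + 2 * M + 1)
        \<le> E * (q powr (2 * (2 * \<alpha> - 1) * (real N)\<^sup>2 / 2) * D ^ N)" for N
    proof -
      let ?d = "2 * N + 2 * M + 1"
      have d: "real ?d = 2 * real N + m" by (simp add: m_def)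
      have "q ^ (N * Suc N) * S ?d / \<bar>x0\<bar> ^ ?d
          \<le> q ^ (N * Suc N) * (C * q powr (\<alpha> * (real ?d)\<^sup>2 / 2 - ((real ?d)\<^sup>2 + real ?d) / 2) * B ^ ?d) / \<bar>x0\<bar> ^ ?d"
        using q_pos x00 by (intro divide_right_mono mult_left_mono S) auto
      also have "\<dots> = C * (q powr real (N * Suc N) * q powr (\<alpha> * (real ?d)\<^sup>2 / 2 - ((real ?d)\<^sup>2 + real ?d) / 2)) * (B / \<bar>x0\<bar>) ^ ?d"
        using q_pos by (simp only: powr_realpow) (simp add: power_divide)
      also have "q powr real (N * Suc N) * q powr (\<alpha> * (real ?d)\<^sup>2 / 2 - ((real ?d)\<^sup>2 + real ?d) / 2)
          = q powr (2 * (2 * \<alpha> - 1) * (real N)\<^sup>2 / 2 + real N * (2 * (\<alpha> - 1) * m) + ((\<alpha> - 1) * m\<^sup>2 / 2 - m / 2))"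
        unfolding d powr_add[symmetric]
        by (rule arg_cong[where f = "\<lambda>u. q powr u"]) (simp add: field_simps power2_eq_square)
      also have "\<dots> = q powr (2 * (2 * \<alpha> - 1) * (real N)\<^sup>2 / 2) * (q powr (2 * (\<alpha> - 1) * m)) ^ N * q powr ((\<alpha> - 1) * m\<^sup>2 / 2 - m / 2)"
        using q_pos unfolding powr_add by (simp add: powr_power mult_ac)
      also have "(B / \<bar>x0\<bar>) ^ ?d = ((B / \<bar>x0\<bar>)\<^sup>2) ^ N * (B / \<bar>x0\<bar>) ^ (2 * M + 1)"
        by (simp add: power_add power_mult)
      finally show ?thesis by (simp add: D_def E_def power_mult_distrib mult_ac)
    qed
    \<comment> \<open>Here the parameter of \<open>summable_gaussian\<close> is
      \<open>2 * (2 * \<alpha> - 1)\<close>, which is positive exactly above the threshold.\<close>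
    have "summable (\<lambda>N::nat. q powr (2 * (2 * \<alpha> - 1) * (real N)\<^sup>2 / 2) * D ^ N)"
      using \<alpha> by (intro summable_gaussian) (auto simp: D_def)
    then have "(\<lambda>N::nat. q powr (2 * (2 * \<alpha> - 1) * (real N)\<^sup>2 / 2) * D ^ N) \<longlonglongrightarrow> 0"
      by (rule summable_LIMSEQ_zero)
    then have "(\<lambda>N::nat. (q ^ M * S 0 + E * (q powr (2 * (2 * \<alpha> - 1) * (real N)\<^sup>2 / 2) * D ^ N)) / c\<^sup>2)
        \<longlonglongrightarrow> (q ^ M * S 0 + E * 0) / c\<^sup>2"
      using c by (intro tendsto_intros) auto
    moreover have "(1 - q) * \<bar>x0\<bar> * cmod (f x0) \<le> (q ^ M * S 0 + E * (q powr (2 * (2 * \<alpha> - 1) * (real N)\<^sup>2 / 2) * D ^ N)) / c\<^sup>2" for N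
    proof -
      have "(1 - q) * \<bar>x0\<bar> * cmod (f x0) \<le> (q ^ M * S 0 + q ^ (N * Suc N) * S (2 * N + 2 * M + 1) / \<bar>x0\<bar> ^ (2 * N + 2 * M + 1)) / c\<^sup>2"
        using vanishing_moments_estimate[OF ann x0 c, of M N] by (simp add: S_def)
      also have "\<dots> \<le> (q ^ M * S 0 + E * (q powr (2 * (2 * \<alpha> - 1) * (real N)\<^sup>2 / 2) * D ^ N)) / c\<^sup>2"
        using bd[of N] by (intro divide_right_mono add_left_mono) auto
      finally show ?thesis .
    qed
    ultimately have "(1 - q) * \<bar>x0\<bar> * cmod (f x0) \<le> (q ^ M * S 0 + E * 0) / c\<^sup>2"
      by (intro LIMSEQ_le_const) auto
    then show ?thesis by simp
  qed
  have "(\<lambda>M. q ^ M * S 0 / c\<^sup>2) \<longlonglongrightarrow> 0 * S 0 / c\<^sup>2"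
    using q_pos q_less_1 c by (intro tendsto_intros LIMSEQ_power_zero) auto
  then have "(1 - q) * \<bar>x0\<bar> * cmod (f x0) \<le> 0 * S 0 / c\<^sup>2"
    using le_M by (intro LIMSEQ_le_const) auto
  then have "cmod (f x0) \<le> 0" using q_less_1 x00 by (simp add: mult_le_0_iff)
  then show "f1 x0 = f2 x0" by (simp add: f_def)
qed

subsection \<open>Explicit functions for $\alpha \le 1/2$\<close>

text \<open>Euler's coefficients \<open>(-1)^j q^(j(j-1)) / ((1-q^2)...(1-q^(2j)))\<close> of the
  infinite product, written through their consecutive quotients so that the recursion is
  immediate.\<close>

definition theta :: "nat \<Rightarrow> real" where
  "theta j = (\<Prod>i<j. - (q ^ (2 * i)) / (1 - q ^ (2 * Suc i)))"

text \<open>Polymorphic because signs and zeros are studied over the reals and holomorphy over the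
  complex numbers; \<open>Theta_of_real\<close> links the two.\<close>

definition Theta :: "'a \<Rightarrow> 'a :: {banach, real_normed_field}" where
  "Theta z = (\<Sum>j. of_real (theta j) * z ^ j)"

text \<open>From \<open>q^(j(j-1)) = q^(j^2) * q^(-j)\<close> and j denominators, each at least
  \<open>1 - q^2\<close>.\<close>

definition theta_rate :: real where
  "theta_rate = 1 / (q * (1 - q\<^sup>2))"

lemma q2_bounds: "0 < q\<^sup>2" "q\<^sup>2 < 1"
  using q_pos q_less_1 by (auto simp: power_less_one_iff)

lemma theta_rate_pos: "theta_rate > 0"
  using q_pos q2_bounds by (simp add: theta_rate_def)

(* The factor 2 ... / 2 is the shape of summable_gaussian with alpha = 2. *)
lemma abs_theta_le: "\<bar>theta j\<bar> \<le> q powr (2 * (real j)\<^sup>2 / 2) * theta_rate ^ j"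
proof (induction j)
  case 0
  show ?case using q_pos by (simp add: theta_def)
next
  case (Suc j)
  have q: "0 < q ^ (2 * Suc j)" "q ^ (2 * Suc j) < 1" using q_even_power_bounds[of "Suc j"] by auto
  have "q ^ (2 * Suc j) \<le> q\<^sup>2" using q_pos q_less_1 by (intro power_decreasing) auto
  then have "\<bar>theta (Suc j)\<bar> \<le> \<bar>theta j\<bar> * (q ^ (2 * j) / (1 - q\<^sup>2))"
    using q q2_bounds q_pos unfolding theta_def prod.lessThan_Suc abs_mult abs_divide
    by (intro mult_left_mono frac_le) auto
  also have "\<dots> \<le> (q powr (2 * (real j)\<^sup>2 / 2) * theta_rate ^ j) * (q ^ (2 * j) / (1 - q\<^sup>2))"
    using Suc q2_bounds q_pos by (intro mult_right_mono) auto
  also have "\<dots> = (q powr ((real j)\<^sup>2) * q powr (real (2 * j)) * q powr 1) * (theta_rate ^ j * (1 / (q * (1 - q\<^sup>2))))"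
    using q_pos by (simp only: powr_realpow) simp
  also have "q powr ((real j)\<^sup>2) * q powr (real (2 * j)) * q powr 1 = q powr (2 * (real (Suc j))\<^sup>2 / 2)"
    unfolding powr_add[symmetric]
    by (rule arg_cong[where f = "\<lambda>u. q powr u"]) (simp add: power2_eq_square algebra_simps)
  finally show ?case by (simp add: theta_rate_def)
qed

lemma summable_theta:
  assumes "\<rho> \<ge> 0"
  shows "summable (\<lambda>j. \<bar>theta j\<bar> * \<rho> ^ j)"
proof (rule summable_comparison_test')
  show "summable (\<lambda>j::nat. q powr (2 * (real j)\<^sup>2 / 2) * (theta_rate * \<rho>) ^ j)"
    using assms theta_rate_pos by (intro summable_gaussian) auto
  show "norm (\<bar>theta j\<bar> * \<rho> ^ j) \<le> q powr (2 * (real j)\<^sup>2 / 2) * (theta_rate * \<rho>) ^ j" for j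
    using mult_right_mono[OF abs_theta_le[of j], of "\<rho> ^ j"] assms
    by (simp add: power_mult_distrib mult_ac abs_mult)
qed

lemma summable_norm_Theta: "summable (\<lambda>j. norm (of_real (theta j) * z ^ j :: 'a :: {banach, real_normed_field}))"
  using summable_theta[of "norm z"] by (simp add: norm_mult norm_power)

lemma Theta_sums: "(\<lambda>j. of_real (theta j) * z ^ j) sums Theta (z :: 'a :: {banach, real_normed_field})"
  unfolding Theta_def by (intro summable_sums summable_norm_cancel[OF summable_norm_Theta])

lemma norm_Theta_le:
  fixes z :: "'a :: {banach, real_normed_field}"
  assumes "norm z \<le> \<rho>"
  shows "norm (Theta z) \<le> (\<Sum>j. \<bar>theta j\<bar> * \<rho> ^ j)"
proof (rule norm_sums_le[OF Theta_sums])
  have "\<rho> \<ge> 0" using assms norm_ge_zero[of z] by linarith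
  then show "(\<lambda>j. \<bar>theta j\<bar> * \<rho> ^ j) sums (\<Sum>j. \<bar>theta j\<bar> * \<rho> ^ j)"
    by (intro summable_sums summable_theta)
  show "norm (of_real (theta j) * z ^ j) \<le> \<bar>theta j\<bar> * \<rho> ^ j" for j
    using assms by (simp add: norm_mult norm_power mult_left_mono power_mono)
qed

lemma Theta_of_real: "Theta (of_real t) = (of_real (Theta t) :: 'a :: {banach, real_normed_field})"
proof -
  have "(\<lambda>j. of_real (theta j) * of_real t ^ j :: 'a) sums of_real (Theta t)"
    using sums_of_real[OF Theta_sums[of t]] by simp
  then show ?thesis using Theta_sums[of "of_real t :: 'a"] sums_unique2 by blast
qed

lemma theta_0: "theta 0 = 1"
  by (simp add: theta_def)

lemma theta_Suc: "theta (Suc j) = q ^ (2 * Suc j) * theta (Suc j) - q ^ (2 * j) * theta j"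
proof -
  have "1 - q ^ (2 * Suc j) \<noteq> 0" using q_even_power_bounds[of "Suc j"] by auto
  moreover have "theta (Suc j) = theta j * (- (q ^ (2 * j)) / (1 - q ^ (2 * Suc j)))"
    by (simp add: theta_def)
  ultimately have "theta (Suc j) * (1 - q ^ (2 * Suc j)) = - (q ^ (2 * j)) * theta j"
    by simp
  then show ?thesis by (simp only: right_diff_distrib mult_1_right) (simp only: mult.commute)
qed

lemma Theta_0: "Theta 0 = 1"
  using Theta_sums[of 0] powser_sums_zero[of "\<lambda>j. of_real (theta j)"] by (simp add: sums_iff theta_0 Theta_def)

text \<open>Splitting off the first factor of the infinite product, proved by comparing coefficients
  via \<open>theta_Suc\<close>. Positivity on \<open>[0, 1)\<close> and the zeros follow by
  iterating it, so the product itself is never formed.\<close>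

lemma Theta_functional_eq: "Theta t = (1 - t) * Theta (q\<^sup>2 * t)" for t :: real
proof -
  define T where "T = Theta (q\<^sup>2 * t)"
  have s: "(\<lambda>j. theta j * (q\<^sup>2 * t) ^ j) sums T"
    using Theta_sums[of "q\<^sup>2 * t"] by (simp add: T_def)
  then have "(\<lambda>j. theta (Suc j) * (q\<^sup>2 * t) ^ Suc j) sums (T - theta 0)"
    by (subst sums_Suc_iff) simp
  then have "(\<lambda>j. theta (Suc j) * (q\<^sup>2 * t) ^ Suc j - t * (theta j * (q\<^sup>2 * t) ^ j)) sums (T - theta 0 - t * T)"
    by (intro sums_diff sums_mult s)
  also have "(\<lambda>j. theta (Suc j) * (q\<^sup>2 * t) ^ Suc j - t * (theta j * (q\<^sup>2 * t) ^ j))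
      = (\<lambda>j. theta (Suc j) * t ^ Suc j)"
  proof
    fix j
    have "theta (Suc j) * (q\<^sup>2 * t) ^ Suc j - t * (theta j * (q\<^sup>2 * t) ^ j)
        = (q ^ (2 * Suc j) * theta (Suc j) - q ^ (2 * j) * theta j) * t ^ Suc j"
      unfolding power_mult_distrib power_mult[symmetric] by (simp add: algebra_simps)
    then show "theta (Suc j) * (q\<^sup>2 * t) ^ Suc j - t * (theta j * (q\<^sup>2 * t) ^ j) = theta (Suc j) * t ^ Suc j"
      unfolding theta_Suc[symmetric] .
  qed
  finally have "(\<lambda>j. theta j * t ^ j) sums (T - theta 0 - t * T + theta 0 * t ^ 0)"
    by (subst (asm) sums_Suc_iff) simp
  moreover have "(\<lambda>j. theta j * t ^ j) sums Theta t" using Theta_sums[of t] by simp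
  ultimately have "Theta t = T - t * T" using sums_unique2 by fastforce
  then show ?thesis by (simp add: T_def left_diff_distrib)
qed

lemma Theta_holomorphic: "Theta holomorphic_on S"
proof -
  have "Theta field_differentiable at z" for z :: complex
  proof -
    have "Theta holomorphic_on ball 0 (cmod z + 1)"
      by (rule power_series_holomorphic[where a = "\<lambda>j. of_real (theta j)"]) (use Theta_sums in simp)
    then show ?thesis by (rule holomorphic_on_imp_differentiable_at) auto
  qed
  then show ?thesis by (simp add: holomorphic_on_def field_differentiable_at_within)
qed

text \<open>For 0 \<le> u < 1 the factor \<open>1 - u\<close> is positive, so a nonpositive value at
  t propagates to all \<open>q^(2m) * t\<close>. These tend to 0, where the value is 1.\<close>

lemma Theta_pos:
  assumes "0 \<le> t" "t < 1"
  shows "0 < Theta (t :: real)"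
proof (rule ccontr)
  assume neg: "\<not> 0 < Theta t"
  have "Theta ((q\<^sup>2) ^ m * t) \<le> 0" for m
  proof (induction m)
    case (Suc m)
    define u where "u = (q\<^sup>2) ^ m * t"
    have "(q\<^sup>2) ^ m \<le> 1"
      by (rule power_le_one[OF less_imp_le[OF q2_bounds(1)] less_imp_le[OF q2_bounds(2)]])
    then have "u \<le> 1 * t" using assms unfolding u_def by (intro mult_right_mono) auto
    then have "0 < 1 - u" using assms by simp
    moreover have "(1 - u) * Theta (q\<^sup>2 * u) \<le> 0" using Suc Theta_functional_eq[of u] by (simp add: u_def)
    ultimately have "Theta (q\<^sup>2 * u) \<le> 0" by (simp add: mult_le_0_iff)
    then show ?case by (simp add: u_def mult.assoc)
  qed (use neg in simp)
  moreover have "(\<lambda>m. Theta ((q\<^sup>2) ^ m * t)) \<longlonglongrightarrow> 1"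
  proof -
    \<comment> \<open>Continuity is taken from the holomorphic function and carried back to real
      arguments by \<open>Theta_of_real\<close>.\<close>
    have "isCont (Theta :: complex \<Rightarrow> complex) 0"
      using holomorphic_on_imp_continuous_on[OF Theta_holomorphic[of UNIV]] by (simp add: continuous_on_eq_continuous_at)
    moreover have "(\<lambda>m. complex_of_real ((q\<^sup>2) ^ m * t)) \<longlonglongrightarrow> of_real 0"
      using q2_bounds by (intro tendsto_of_real tendsto_mult_left_zero LIMSEQ_power_zero) auto
    ultimately have "(\<lambda>m. Theta (complex_of_real ((q\<^sup>2) ^ m * t))) \<longlonglongrightarrow> Theta 0"
      by (intro isCont_tendsto_compose[of 0 Theta]) auto
    then have "(\<lambda>m. complex_of_real (Theta ((q\<^sup>2) ^ m * t))) \<longlonglongrightarrow> complex_of_real 1"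
      unfolding Theta_of_real Theta_0 by simp
    then show ?thesis by (simp only: tendsto_of_real_iff)
  qed
  ultimately have "(1::real) \<le> 0" by (intro LIMSEQ_le_const2) auto
  then show False by simp
qed

lemma Theta_zero: "Theta (inverse q ^ (2 * i)) = (0 :: real)"
proof (induction i)
  case 0
  show ?case using Theta_functional_eq[of 1] by simp
next
  case (Suc i)
  have "q\<^sup>2 * inverse q ^ (2 * Suc i) = inverse q ^ (2 * i)"
    using q_pos by (simp add: power2_eq_square field_simps)
  then have "Theta (inverse q ^ (2 * Suc i)) = (1 - inverse q ^ (2 * Suc i)) * Theta (inverse q ^ (2 * i))"
    using Theta_functional_eq[of "inverse q ^ (2 * Suc i)"] by (simp only:)
  then show ?case by (simp only: Suc mult_zero_right)
qed

section \<open>An entire function with bounded support on the lattice\<close>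

definition bump :: "real \<Rightarrow> real" where
  "bump x = Theta ((x / \<gamma>)\<^sup>2)"

text \<open>At such points \<open>(x / \<gamma>)^2\<close> is \<open>q^(-2i)\<close> with i \<ge> 0,
  a zero of \<open>Theta\<close>.\<close>

lemma bump_eq_0:
  assumes "x \<in> L" "\<gamma> \<le> \<bar>x\<bar>"
  shows "bump x = 0"
proof -
  obtain j where j: "j \<in> J" "x = pt j" using assms(1) by (auto simp: L_eq_pt_image)
  then have x: "\<bar>x\<bar> = q powi fst j * \<gamma>" using abs_pt by simp
  have "fst j \<le> 0"
  proof (rule ccontr)
    assume "\<not> fst j \<le> 0"
    then have "q powi fst j < 1"
      using q_pos q_less_1 by (simp add: power_int_def power_less_one_iff)
    then have "q powi fst j * \<gamma> < 1 * \<gamma>" using gamma_pos by (intro mult_strict_right_mono) auto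
    then show False using assms(2) x by simp
  qed
  then have "q powi fst j = inverse q ^ nat (- fst j)"
    by (auto simp: power_int_def)
  then have "(x / \<gamma>)\<^sup>2 = inverse q ^ (2 * nat (- fst j))"
    using x gamma_pos power2_abs[of "x / \<gamma>"] by (simp add: abs_divide power_mult mult.commute flip: power_mult)
  then show ?thesis unfolding bump_def by (simp only: Theta_zero)
qed

lemma bump_bound: "\<bar>x\<bar> \<le> \<gamma> \<Longrightarrow> \<bar>bump x\<bar> \<le> (\<Sum>j. \<bar>theta j\<bar> * 1 ^ j)"
  using norm_Theta_le[of "(x / \<gamma>)\<^sup>2" 1] gamma_pos by (simp add: bump_def abs_square_le_1)

lemma bump_integrable: "qintegrable q \<gamma> (\<lambda>x. bump x * x ^ n)"
proof (rule qintegrable_bounded_support)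
  fix x assume x: "\<bar>x\<bar> \<le> \<gamma>"
  have "\<bar>bump x\<bar> * \<bar>x\<bar> ^ n \<le> (\<Sum>j. \<bar>theta j\<bar> * 1 ^ j) * \<gamma> ^ n"
    using x bump_bound[OF x] by (intro mult_mono power_mono) auto
  then show "norm (bump x * x ^ n) \<le> (\<Sum>j. \<bar>theta j\<bar> * 1 ^ j) * \<gamma> ^ n"
    by (simp add: abs_mult power_abs)
qed (simp add: bump_eq_0)

lemma bump_abs_moment: "qint q \<gamma> (\<lambda>x. \<bar>bump x * x ^ n\<bar>) \<le> \<gamma> ^ n * qint q \<gamma> (\<lambda>x. \<bar>bump x\<bar>)"
proof -
  have I: "qintegrable q \<gamma> (\<lambda>x. \<bar>bump x * x ^ k\<bar>)" for k
    using bump_integrable[of k] qintegrable_norm_iff[of "\<lambda>x. bump x * x ^ k"] by simp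
  have "qint q \<gamma> (\<lambda>x. \<bar>bump x * x ^ n\<bar>) \<le> qint q \<gamma> (\<lambda>x. \<gamma> ^ n * \<bar>bump x\<bar>)"
  proof (rule qint_mono)
    fix x assume x: "x \<in> L"
    show "\<bar>bump x * x ^ n\<bar> \<le> \<gamma> ^ n * \<bar>bump x\<bar>"
    proof (cases "\<gamma> \<le> \<bar>x\<bar>")
      case False
      then have "\<bar>x\<bar> ^ n \<le> \<gamma> ^ n" by (intro power_mono) auto
      then show ?thesis
        using mult_right_mono[of "\<bar>x\<bar> ^ n" "\<gamma> ^ n" "\<bar>bump x\<bar>"] by (simp add: abs_mult power_abs mult.commute)
    qed (simp add: bump_eq_0[OF x])
  qed (use I[of n] I[of 0] in \<open>auto intro!: qintegrable_cmult\<close>)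
  also have "\<dots> = \<gamma> ^ n * qint q \<gamma> (\<lambda>x. \<bar>bump x\<bar>)" by (rule qint_cmult)
  finally show ?thesis .
qed

lemma bump_odd_moment: "odd n \<Longrightarrow> qint q \<gamma> (\<lambda>x. bump x * x ^ n) = 0"
  using qint_reflect[of "\<lambda>x. bump x * x ^ n"] qint_cmult[of "-1" "\<lambda>x. bump x * x ^ n"]
  by (simp add: bump_def)

text \<open>On the lattice the function is 0 from \<gamma> on and positive below, as its argument is
  then in \<open>[0, 1)\<close>; the point \<open>q * \<gamma>\<close> witnesses strictness. This
  keeps the zeroth moment of \<open>wave 1\<close> from vanishing.\<close>

lemma bump_integral_pos: "0 < qint q \<gamma> bump"
proof -
  have nonneg: "0 \<le> bump x" if x: "x \<in> L" for x
  proof (cases "\<gamma> \<le> \<bar>x\<bar>")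
    case False
    then have "(x / \<gamma>)\<^sup>2 < 1" using gamma_pos by (simp add: abs_square_less_1)
    then show ?thesis unfolding bump_def using Theta_pos[of "(x / \<gamma>)\<^sup>2"] by simp
  qed (simp add: bump_eq_0[OF x])
  have x: "q * \<gamma> \<in> L" using qpower_gamma_in_L(1)[of 1] by simp
  have "0 < bump (q * \<gamma>)"
    unfolding bump_def using Theta_pos[of "q\<^sup>2"] q2_bounds gamma_pos by simp
  then have "0 < (1 - q) * \<bar>q * \<gamma>\<bar> * norm (bump (q * \<gamma>))"
    using q_less_1 q_pos gamma_pos by simp
  also have "\<dots> \<le> qint q \<gamma> (\<lambda>x. norm (bump x))"
    using norm_le_qint[OF _ x, of bump] bump_integrable[of 0] by simp
  also have "\<dots> = qint q \<gamma> bump" by (rule qint_cong) (simp add: nonneg)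
  finally show ?thesis .
qed

text \<open>Replacing x by \<open>q^j * x\<close> multiplies the n-th integral by
  \<open>q^(-(n+1)j)\<close>, so weighting with \<open>q^((2s+1)j)\<close> sums these factors to
  \<open>Theta\<close> at \<open>q^(2s-n)\<close>. The extra 1 in the exponent offsets the weight of
  the integral. For even n \<ge> 2s the argument is a zero of \<open>Theta\<close>, so
  \<open>s\<close> shifts where the vanishing starts.\<close>

definition wave_coeff :: "nat \<Rightarrow> nat \<Rightarrow> real" where
  "wave_coeff s j = theta j * (q ^ (2 * s + 1)) ^ j"

(* The function f_s, with E = bump. *)
definition wave :: "nat \<Rightarrow> real \<Rightarrow> real" where
  "wave s x = (\<Sum>j. wave_coeff s j * bump (q ^ j * x))"

lemma abs_wave_coeff_le: "\<bar>wave_coeff s j\<bar> \<le> q powr (2 * (real j)\<^sup>2 / 2) * theta_rate ^ j * q ^ j"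
proof -
  have "(q ^ (2 * s + 1)) ^ j \<le> (q ^ 1) ^ j"
    using q_pos q_less_1 by (intro power_mono power_decreasing) auto
  then show ?thesis
    unfolding wave_coeff_def abs_mult using q_pos theta_rate_pos abs_theta_le[of j]
    by (intro mult_mono) auto
qed

lemma bump_scaled:
  "qintegrable q \<gamma> (\<lambda>x. bump (q ^ j * x) * x ^ n)"
  "qint q \<gamma> (\<lambda>x. bump (q ^ j * x) * x ^ n) = (inverse q ^ Suc n) ^ j * qint q \<gamma> (\<lambda>x. bump x * x ^ n)"
  "qint q \<gamma> (\<lambda>x. \<bar>bump (q ^ j * x) * x ^ n\<bar>) = (inverse q ^ Suc n) ^ j * qint q \<gamma> (\<lambda>x. \<bar>bump x * x ^ n\<bar>)"
proof -
  have eq: "bump (q ^ j * x) * x ^ n = (inverse q ^ n) ^ j * (bump (q powi (int j) * x) * (q powi (int j) * x) ^ n)" for x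
    using q_pos by (simp add: power_mult_distrib field_simps flip: power_mult)
  show "qintegrable q \<gamma> (\<lambda>x. bump (q ^ j * x) * x ^ n)"
    unfolding eq by (rule qintegrable_cmult[OF qintegrable_scale[OF bump_integrable]])
  show "qint q \<gamma> (\<lambda>x. bump (q ^ j * x) * x ^ n) = (inverse q ^ Suc n) ^ j * qint q \<gamma> (\<lambda>x. bump x * x ^ n)"
    unfolding eq qint_cmult qint_scale[of "\<lambda>x. bump x * x ^ n"] by (simp add: power_int_minus power_mult_distrib power_inverse)
  have abs_eq: "\<bar>bump (q ^ j * x) * x ^ n\<bar> = (inverse q ^ n) ^ j * \<bar>bump (q powi (int j) * x) * (q powi (int j) * x) ^ n\<bar>" for x
    unfolding eq abs_mult using q_pos by simp
  show "qint q \<gamma> (\<lambda>x. \<bar>bump (q ^ j * x) * x ^ n\<bar>) = (inverse q ^ Suc n) ^ j * qint q \<gamma> (\<lambda>x. \<bar>bump x * x ^ n\<bar>)"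
    unfolding abs_eq qint_cmult qint_scale[of "\<lambda>x. \<bar>bump x * x ^ n\<bar>"]
    by (simp add: power_int_minus power_mult_distrib power_inverse)
qed

text \<open>Completing the square in j:
  \<open>j^2 - nj - \<beta> j \<ge> -(n + \<beta>)^2 / 4\<close>. The number \<beta> is chosen so
  that \<open>q powr (-\<beta>) = 2 * theta_rate\<close>; the spare 2 leaves the geometric factor
  \<open>(1 / 2)^j\<close>, which makes the bound summable in j.\<close>

lemma gaussian_term_bound:
  obtains \<beta> where "\<And>s j n. \<bar>wave_coeff s j\<bar> * (inverse q ^ Suc n) ^ j \<le> q powr (- (real n + \<beta>)\<^sup>2 / 4) * (1 / 2) ^ j"
proof -
  define \<beta> where "\<beta> = - log q (2 * theta_rate)"
  have \<beta>: "q powr (- \<beta>) = 2 * theta_rate" using q_pos q_less_1 theta_rate_pos by (simp add: \<beta>_def)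
  have "\<bar>wave_coeff s j\<bar> * (inverse q ^ Suc n) ^ j \<le> q powr (- (real n + \<beta>)\<^sup>2 / 4) * (1 / 2) ^ j" for s j n
  proof -
    have "\<bar>wave_coeff s j\<bar> * (inverse q ^ Suc n) ^ j \<le> q powr (2 * (real j)\<^sup>2 / 2) * theta_rate ^ j * q ^ j * (inverse q ^ Suc n) ^ j"
      using q_pos by (intro mult_right_mono abs_wave_coeff_le) auto
    also have "\<dots> = q powr ((real j)\<^sup>2) * (inverse q ^ n) ^ j * (2 * theta_rate) ^ j * (1 / 2) ^ j"
      using q_pos by (simp add: power_mult_distrib field_simps)
    also have "(inverse q ^ n) ^ j = q powr (- (real n * real j))"
      using q_pos by (simp add: powr_minus powr_realpow flip: power_mult of_nat_mult power_inverse)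
    also have "(2 * theta_rate) ^ j = q powr (- \<beta> * real j)"
      unfolding \<beta>[symmetric] using q_pos by (simp add: powr_power mult.commute)
    also have "q powr ((real j)\<^sup>2) * q powr (- (real n * real j)) * q powr (- \<beta> * real j)
        = q powr ((real j)\<^sup>2 - real n * real j - \<beta> * real j)"
      by (simp flip: powr_add)
    also have "\<dots> \<le> q powr (- (real n + \<beta>)\<^sup>2 / 4)"
    proof (rule powr_mono')
      have "0 \<le> (real j - (real n + \<beta>) / 2)\<^sup>2" by simp
      then show "- (real n + \<beta>)\<^sup>2 / 4 \<le> (real j)\<^sup>2 - real n * real j - \<beta> * real j"
        by (simp add: power2_eq_square field_simps)
    qed (use q_pos q_less_1 in auto)
    finally show ?thesis by simp
  qed
  then show thesis by (rule that)
qed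

lemma
  fixes s n :: nat
  defines "T \<equiv> \<lambda>j x. wave_coeff s j * (bump (q ^ j * x) * x ^ n)"
  shows wave_term_integrable: "\<And>j. qintegrable q \<gamma> (T j)"
    and wave_term_summable: "summable (\<lambda>j. qint q \<gamma> (\<lambda>x. norm (T j x)))"
    and wave_term_norm: "\<And>j. qint q \<gamma> (\<lambda>x. norm (T j x))
      = \<bar>wave_coeff s j\<bar> * (inverse q ^ Suc n) ^ j * qint q \<gamma> (\<lambda>x. \<bar>bump x * x ^ n\<bar>)"
proof -
  show "qintegrable q \<gamma> (T j)" for j unfolding T_def by (rule qintegrable_cmult[OF bump_scaled(1)])
  show eq: "qint q \<gamma> (\<lambda>x. norm (T j x))
      = \<bar>wave_coeff s j\<bar> * (inverse q ^ Suc n) ^ j * qint q \<gamma> (\<lambda>x. \<bar>bump x * x ^ n\<bar>)" for j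
    unfolding T_def real_norm_def abs_mult[of "wave_coeff s j"] qint_cmult bump_scaled(3) by simp
  obtain \<beta> where \<beta>: "\<And>s j n. \<bar>wave_coeff s j\<bar> * (inverse q ^ Suc n) ^ j \<le> q powr (- (real n + \<beta>)\<^sup>2 / 4) * (1 / 2) ^ j"
    using gaussian_term_bound by blast
  have "summable (\<lambda>j. \<bar>wave_coeff s j\<bar> * (inverse q ^ Suc n) ^ j)"
  proof (rule summable_comparison_test')
    show "summable (\<lambda>j. q powr (- (real n + \<beta>)\<^sup>2 / 4) * (1 / 2) ^ j)"
      by (intro summable_mult summable_geometric) simp
    show "norm (\<bar>wave_coeff s j\<bar> * (inverse q ^ Suc n) ^ j) \<le> q powr (- (real n + \<beta>)\<^sup>2 / 4) * (1 / 2) ^ j" for j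
      using \<beta>[of s j n] q_pos by (simp add: abs_mult)
  qed
  then show "summable (\<lambda>j. qint q \<gamma> (\<lambda>x. norm (T j x)))"
    unfolding eq by (rule summable_mult2)
qed

lemma wave_mult_power:
  assumes "x \<in> L"
  shows "wave s x * x ^ n = (\<Sum>j. wave_coeff s j * (bump (q ^ j * x) * x ^ n))"
proof -
  have "summable (\<lambda>j. wave_coeff s j * (bump (q ^ j * x) * x ^ 0))"
    by (rule summable_norm_cancel[OF summable_norm_on_L[OF wave_term_integrable wave_term_summable assms]])
  then have "summable (\<lambda>j. wave_coeff s j * bump (q ^ j * x))" by simp
  from suminf_mult2[OF this, of "x ^ n"] show ?thesis
    by (simp add: wave_def mult.assoc)
qed

lemma wave_integrable: "qintegrable q \<gamma> (\<lambda>x. wave s x * x ^ n)"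
proof -
  have "qintegrable q \<gamma> (\<lambda>x. wave s x * x ^ n) \<longleftrightarrow>
      qintegrable q \<gamma> (\<lambda>x. \<Sum>j. wave_coeff s j * (bump (q ^ j * x) * x ^ n))"
    by (rule qintegrable_cong) (rule wave_mult_power)
  then show ?thesis using qintegrable_suminf[OF wave_term_integrable wave_term_summable] by simp
qed

lemma wave_moment: "qint q \<gamma> (\<lambda>x. wave s x * x ^ n) = Theta (q powi (2 * int s - int n)) * qint q \<gamma> (\<lambda>x. bump x * x ^ n)"
proof -
  have "qint q \<gamma> (\<lambda>x. wave s x * x ^ n) = qint q \<gamma> (\<lambda>x. \<Sum>j. wave_coeff s j * (bump (q ^ j * x) * x ^ n))"
    by (rule qint_cong) (rule wave_mult_power)
  then have 1: "(\<lambda>j. qint q \<gamma> (\<lambda>x. wave_coeff s j * (bump (q ^ j * x) * x ^ n))) sums qint q \<gamma> (\<lambda>x. wave s x * x ^ n)"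
    using qint_suminf[OF wave_term_integrable wave_term_summable, of s n] by simp
  have 2: "(\<lambda>j. qint q \<gamma> (\<lambda>x. wave_coeff s j * (bump (q ^ j * x) * x ^ n)))
      = (\<lambda>j. theta j * (q powi (2 * int s - int n)) ^ j * qint q \<gamma> (\<lambda>x. bump x * x ^ n))"
  proof
    fix j
    have "q powi (2 * int s - int n) = q ^ (2 * s + 1) * inverse q ^ Suc n"
      using q_pos by (simp add: power_int_diff power_int_mult field_simps power_mult)
    then show "qint q \<gamma> (\<lambda>x. wave_coeff s j * (bump (q ^ j * x) * x ^ n))
      = theta j * (q powi (2 * int s - int n)) ^ j * qint q \<gamma> (\<lambda>x. bump x * x ^ n)"
      unfolding qint_cmult bump_scaled(2) wave_coeff_def by (simp only: power_mult_distrib mult_ac)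
  qed
  have 3: "(\<lambda>j. theta j * (q powi (2 * int s - int n)) ^ j * qint q \<gamma> (\<lambda>x. bump x * x ^ n))
      sums (Theta (q powi (2 * int s - int n)) * qint q \<gamma> (\<lambda>x. bump x * x ^ n))"
    using Theta_sums[of "q powi (2 * int s - int n)"] by (intro sums_mult2) simp
  show ?thesis using 1 3 unfolding 2 by (rule sums_unique2)
qed

lemma wave_moment_eq_0:
  assumes "odd n \<or> 2 * s \<le> n"
  shows "qint q \<gamma> (\<lambda>x. wave s x * x ^ n) = 0"
proof (cases "odd n")
  case True
  then show ?thesis by (simp add: wave_moment bump_odd_moment)
next
  case False
  then obtain i where n: "n = 2 * s + 2 * i" using assms by (metis dvd_diff_nat dvd_triv_left evenE le_add_diff_inverse)
  have "2 * int s - int n = - int (2 * i)" using n by simp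
  then have "q powi (2 * int s - int n) = inverse q ^ (2 * i)"
    by (simp only: power_int_minus power_int_of_nat power_inverse)
  then show ?thesis unfolding wave_moment by (simp only: Theta_zero mult_zero_left)
qed

lemma wave_1_integral: "qint q \<gamma> (\<lambda>x. wave 1 x * x ^ 0) \<noteq> 0"
proof -
  have "q powi (2 * int 1 - int 0) = q\<^sup>2" by (simp add: power_int_def)
  then have "qint q \<gamma> (\<lambda>x. wave 1 x * x ^ 0) = Theta (q\<^sup>2) * qint q \<gamma> bump"
    unfolding wave_moment by simp
  moreover have "Theta (q\<^sup>2) > 0" using q2_bounds by (intro Theta_pos) auto
  ultimately show ?thesis using bump_integral_pos by simp
qed

text \<open>The exponent \<open>(n^2 + n)/2 - (n + \<beta>)^2/4\<close> has leading term
  \<open>n^2/4\<close>; its linear part and the factor \<open>\<gamma>^n\<close> from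
  \<open>bump_abs_moment\<close> go into \<open>B\<close>, its constant part into
  \<open>C\<close>.\<close>

lemma wave_abs_moment_bound:
  obtains C B where "C > 0" "B > 0"
    "\<And>n. q powr (((real n)\<^sup>2 + real n) / 2) * qint q \<gamma> (\<lambda>x. \<bar>wave s x * x ^ n\<bar>)
      \<le> C * (q powr ((real n)\<^sup>2 / 4) * B ^ n)"
proof -
  obtain \<beta> where \<beta>: "\<And>s j n. \<bar>wave_coeff s j\<bar> * (inverse q ^ Suc n) ^ j \<le> q powr (- (real n + \<beta>)\<^sup>2 / 4) * (1 / 2) ^ j"
    using gaussian_term_bound by blast
  define S where "S = qint q \<gamma> (\<lambda>x. \<bar>bump x\<bar>)"
  have S: "S \<ge> 0" unfolding S_def by (rule qint_nonneg) simp
  \<comment> \<open>\<open>S + 1\<close> instead of \<open>S\<close> makes positivity of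
    \<open>C\<close> immediate.\<close>
  define C where "C = 2 * (S + 1) * q powr (- \<beta>\<^sup>2 / 4)"
  define B where "B = q powr ((1 - \<beta>) / 2) * \<gamma>"
  have "q powr (((real n)\<^sup>2 + real n) / 2) * qint q \<gamma> (\<lambda>x. \<bar>wave s x * x ^ n\<bar>)
      \<le> C * (q powr ((real n)\<^sup>2 / 4) * B ^ n)" for n
  proof -
    define I where "I = qint q \<gamma> (\<lambda>x. \<bar>bump x * x ^ n\<bar>)"
    have I: "0 \<le> I" "I \<le> \<gamma> ^ n * S"
      using bump_abs_moment[of n] by (auto simp: I_def S_def intro: qint_nonneg)
    define G where "G = q powr (- (real n + \<beta>)\<^sup>2 / 4)"
    have "qint q \<gamma> (\<lambda>x. \<bar>wave s x * x ^ n\<bar>) = qint q \<gamma> (\<lambda>x. norm (\<Sum>j. wave_coeff s j * (bump (q ^ j * x) * x ^ n)))"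
      by (rule qint_cong) (simp add: wave_mult_power)
    also have "\<dots> \<le> (\<Sum>j. qint q \<gamma> (\<lambda>x. norm (wave_coeff s j * (bump (q ^ j * x) * x ^ n))))"
      by (rule qint_norm_suminf_le[OF wave_term_integrable wave_term_summable])
    also have "\<dots> \<le> (\<Sum>j. G * (1 / 2) ^ j * I)"
    proof (rule suminf_le)
      show "qint q \<gamma> (\<lambda>x. norm (wave_coeff s j * (bump (q ^ j * x) * x ^ n))) \<le> G * (1 / 2) ^ j * I" for j
        unfolding wave_term_norm I_def[symmetric] G_def using \<beta> I(1) by (rule mult_right_mono)
      show "summable (\<lambda>j. G * (1 / 2) ^ j * I)"
        by (intro summable_mult summable_mult2 summable_geometric) simp
    qed (rule wave_term_summable)
    also have "\<dots> = 2 * G * I"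
      using sums_unique[OF sums_mult2[OF sums_mult[OF geometric_sums[of "1 / 2 :: real"], of G], of I]] by simp
    also have "\<dots> \<le> 2 * G * (\<gamma> ^ n * (S + 1))"
      using I gamma_pos by (intro mult_left_mono order_trans[OF I(2)]) (auto simp: G_def)
    finally have "q powr (((real n)\<^sup>2 + real n) / 2) * qint q \<gamma> (\<lambda>x. \<bar>wave s x * x ^ n\<bar>)
        \<le> q powr (((real n)\<^sup>2 + real n) / 2) * (2 * G * (\<gamma> ^ n * (S + 1)))"
      by (intro mult_left_mono) auto
    also have "\<dots> = 2 * (S + 1) * \<gamma> ^ n * (q powr (((real n)\<^sup>2 + real n) / 2) * G)" by simp
    also have "q powr (((real n)\<^sup>2 + real n) / 2) * G = q powr (- \<beta>\<^sup>2 / 4 + (real n)\<^sup>2 / 4 + real n * ((1 - \<beta>) / 2))"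
      unfolding G_def powr_add[symmetric]
      by (rule arg_cong[where f = "\<lambda>u. q powr u"]) (simp add: power2_eq_square field_simps)
    also have "\<dots> = q powr (- \<beta>\<^sup>2 / 4) * q powr ((real n)\<^sup>2 / 4) * (q powr ((1 - \<beta>) / 2)) ^ n"
      unfolding powr_add using q_pos by (simp add: powr_power mult_ac)
    finally show ?thesis by (simp add: C_def B_def power_mult_distrib mult_ac)
  qed
  moreover have "C > 0" "B > 0" using S q_pos gamma_pos by (auto simp: C_def B_def)
  ultimately show thesis using that by blast
qed

section \<open>Entire extension and membership in the function space\<close>

definition wave_ext :: "nat \<Rightarrow> complex \<Rightarrow> complex" where
  "wave_ext s z = (\<Sum>j. of_real (wave_coeff s j) * Theta ((of_real (q ^ j) * z / of_real \<gamma>)\<^sup>2))"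

lemma wave_ext_of_real:
  assumes "x \<in> L"
  shows "wave_ext s (of_real x) = of_real (wave s x)"
proof -
  have "summable (\<lambda>j. wave_coeff s j * (bump (q ^ j * x) * x ^ 0))"
    by (rule summable_norm_cancel[OF summable_norm_on_L[OF wave_term_integrable wave_term_summable assms]])
  then have "of_real (wave s x) = (\<Sum>j. complex_of_real (wave_coeff s j * bump (q ^ j * x)))"
    unfolding wave_def by (intro suminf_of_real) simp
  also have "\<dots> = wave_ext s (of_real x)"
    unfolding wave_ext_def bump_def of_real_mult Theta_of_real[symmetric] by simp
  finally show ?thesis by simp
qed

lemma summable_wave_coeff: "summable (\<lambda>j. \<bar>wave_coeff s j\<bar>)"
proof (rule summable_comparison_test')
  show "summable (\<lambda>j::nat. q powr (2 * (real j)\<^sup>2 / 2) * (theta_rate * q) ^ j)"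
    using theta_rate_pos q_pos by (intro summable_gaussian) auto
  show "norm \<bar>wave_coeff s j\<bar> \<le> q powr (2 * (real j)\<^sup>2 / 2) * (theta_rate * q) ^ j" for j
    using abs_wave_coeff_le[of s j] by (simp add: power_mult_distrib mult_ac)
qed

text \<open>Since \<open>q^j \<le> 1\<close>, the arguments of \<open>Theta\<close> stay in one disc
  while z ranges over a bounded set. One bound K then serves all j, and the summable coefficients
  give locally uniform convergence.\<close>

lemma wave_ext_holomorphic: "wave_ext s holomorphic_on UNIV"
proof (rule holomorphic_uniform_sequence)
  show "(\<lambda>z. \<Sum>j<n. of_real (wave_coeff s j) * Theta ((of_real (q ^ j) * z / of_real \<gamma>)\<^sup>2)) holomorphic_on UNIV" for n
  proof (intro holomorphic_on_sum holomorphic_on_mult holomorphic_on_const)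
    fix j
    have "Theta \<circ> (\<lambda>z. (of_real (q ^ j) * z / of_real \<gamma>)\<^sup>2) holomorphic_on UNIV"
      using gamma_pos by (intro holomorphic_on_compose Theta_holomorphic holomorphic_intros) auto
    then show "(\<lambda>z. Theta ((of_real (q ^ j) * z / of_real \<gamma>)\<^sup>2)) holomorphic_on UNIV"
      by (simp add: o_def)
  qed
  fix z :: complex
  define \<rho> where "\<rho> = ((cmod z + 1) / \<gamma>)\<^sup>2"
  define K where "K = (\<Sum>j. \<bar>theta j\<bar> * \<rho> ^ j)"
  have "uniform_limit (cball z 1)
      (\<lambda>n z. \<Sum>j<n. of_real (wave_coeff s j) * Theta ((of_real (q ^ j) * z / of_real \<gamma>)\<^sup>2)) (wave_ext s) sequentially"
    unfolding wave_ext_def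
  proof (rule Weierstrass_m_test)
    show "summable (\<lambda>j. \<bar>wave_coeff s j\<bar> * K)" by (rule summable_mult2[OF summable_wave_coeff])
    fix j w assume "w \<in> cball z 1"
    then have "cmod w \<le> cmod z + 1"
      using norm_triangle_ineq2[of w z] by (simp add: dist_norm norm_minus_commute)
    moreover have "q ^ j \<le> 1" using q_pos q_less_1 by (intro power_le_one) auto
    ultimately have "q ^ j * cmod w \<le> 1 * (cmod z + 1)"
      using q_pos by (intro mult_mono) auto
    then have "cmod (of_real (q ^ j) * w / of_real \<gamma>) \<le> (cmod z + 1) / \<gamma>"
      using gamma_pos q_pos by (simp add: norm_mult norm_divide norm_power divide_right_mono)
    then have "cmod ((of_real (q ^ j) * w / of_real \<gamma>)\<^sup>2) \<le> \<rho>"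
      unfolding \<rho>_def norm_power by (intro power_mono) auto
    then have "cmod (Theta ((of_real (q ^ j) * w / of_real \<gamma>)\<^sup>2)) \<le> K"
      unfolding K_def by (rule norm_Theta_le)
    then show "norm (of_real (wave_coeff s j) * Theta ((of_real (q ^ j) * w / of_real \<gamma>)\<^sup>2)) \<le> \<bar>wave_coeff s j\<bar> * K"
      unfolding norm_mult norm_of_real by (rule mult_left_mono) simp
  qed
  then show "\<exists>d>0. cball z d \<subseteq> UNIV \<and> uniform_limit (cball z d)
      (\<lambda>n z. \<Sum>j<n. of_real (wave_coeff s j) * Theta ((of_real (q ^ j) * z / of_real \<gamma>)\<^sup>2)) (wave_ext s) sequentially"
    by (intro exI[of _ 1]) simp
qed simp

lemma qint_of_real:
  assumes "qintegrable q \<gamma> f"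
  shows "qint q \<gamma> (\<lambda>x. complex_of_real (f x)) = of_real (qint q \<gamma> f)"
proof -
  have "infsum (\<lambda>j. \<bar>pt j\<bar> *\<^sub>R complex_of_real (f (pt j))) J = infsum (\<lambda>j. complex_of_real (\<bar>pt j\<bar> * f (pt j))) J"
    by (simp add: scaleR_conv_of_real)
  also have "\<dots> = of_real (infsum (\<lambda>j. \<bar>pt j\<bar> * f (pt j)) J)"
    using qintegrable_summable[OF assms] by (intro infsumI has_sum_of_real has_sum_infsum) simp
  finally show ?thesis
    unfolding qint_eq by (simp add: scaleR_conv_of_real)
qed

lemma wave_in_HS:
  assumes "\<alpha> \<le> 1 / 2"
  shows "(\<lambda>x. of_real (wave s x)) \<in> HS_space q \<gamma> \<alpha>"
proof -
  let ?f = "\<lambda>x. complex_of_real (wave s x)"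
  have eq: "?f x * of_real x ^ n = of_real (wave s x * x ^ n)" for x n by simp
  have "qintegrable q \<gamma> (\<lambda>x. ?f x * of_real x ^ n)" for n
    using wave_integrable[of s n] unfolding eq qintegrable_iff by (simp only: norm_of_real real_norm_def)
  moreover obtain C B where CB: "C > 0" "B > 0"
    "\<And>n. q powr (((real n)\<^sup>2 + real n) / 2) * qint q \<gamma> (\<lambda>x. \<bar>wave s x * x ^ n\<bar>) \<le> C * (q powr ((real n)\<^sup>2 / 4) * B ^ n)"
    using wave_abs_moment_bound[of s] by blast
  have "(\<lambda>n. abs_qmoment q \<gamma> n ?f) \<in> O(\<lambda>n. q powr (\<alpha> * (real n)\<^sup>2 / 2) * B ^ n)"
  proof (rule landau_o.bigI[of C], rule CB(1), intro always_eventually allI)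
    fix n
    have "abs_qmoment q \<gamma> n ?f = q powr (((real n)\<^sup>2 + real n) / 2) * qint q \<gamma> (\<lambda>x. \<bar>wave s x * x ^ n\<bar>)"
      unfolding abs_qmoment_def q_power_triangle eq norm_of_real ..
    also have "\<dots> \<le> C * (q powr ((real n)\<^sup>2 / 4) * B ^ n)" by (rule CB(3))
    \<comment> \<open>The assumption on \<alpha> enters here: since q < 1, the smaller exponent
      gives the larger power.\<close>
    also have "\<dots> \<le> C * (q powr (\<alpha> * (real n)\<^sup>2 / 2) * B ^ n)"
    proof (intro mult_left_mono mult_right_mono powr_mono')
      show "\<alpha> * (real n)\<^sup>2 / 2 \<le> (real n)\<^sup>2 / 4"
        using mult_right_mono[OF assms, of "(real n)\<^sup>2"] by simp
    qed (use CB q_pos q_less_1 in auto)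
    finally show "norm (abs_qmoment q \<gamma> n ?f) \<le> C * norm (q powr (\<alpha> * (real n)\<^sup>2 / 2) * B ^ n)"
      using CB abs_qmoment_nonneg[of n ?f] by simp
  qed
  moreover have "wave_ext s holomorphic_on {z. \<bar>Im z\<bar> < 1}"
    using wave_ext_holomorphic holomorphic_on_subset by blast
  ultimately show ?thesis
    unfolding HS_space_def I_inf_def mem_Collect_eq using CB(2) wave_ext_of_real
    by (intro conjI allI exI[of _ B] exI[of _ "1::real"] exI[of _ "wave_ext s"]) auto
qed

text \<open>The lattice accumulates at 0, so vanishing on it would force the extension to vanish at
  0. There every \<open>Theta\<close> value is 1, and the coefficients \<open>theta j * q^j\<close>
  sum to \<open>Theta q\<close>, which is positive.\<close>

lemma wave_nonzero: "\<exists>x\<in>L. wave 0 x \<noteq> 0"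
proof (rule ccontr)
  assume "\<not> ?thesis"
  then have z: "wave_ext 0 (of_real (q ^ N * \<gamma>)) = 0" for N
    using qpower_gamma_in_L(1)[of "int N"] wave_ext_of_real[of "q ^ N * \<gamma>" 0] by simp
  have "isCont (wave_ext 0) 0"
    using holomorphic_on_imp_continuous_on[OF wave_ext_holomorphic] by (simp add: continuous_on_eq_continuous_at)
  moreover have "(\<lambda>N. complex_of_real (q ^ N * \<gamma>)) \<longlonglongrightarrow> of_real 0"
    using q_pos q_less_1 by (intro tendsto_of_real tendsto_mult_left_zero LIMSEQ_power_zero) auto
  ultimately have "(\<lambda>N. wave_ext 0 (complex_of_real (q ^ N * \<gamma>))) \<longlonglongrightarrow> wave_ext 0 0"
    by (intro isCont_tendsto_compose[of 0 "wave_ext 0"]) auto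
  then have "wave_ext 0 0 = 0" unfolding z by (simp add: LIMSEQ_const_iff)
  moreover have "wave_ext 0 0 = Theta (of_real q)"
    by (simp add: wave_ext_def Theta_0 wave_coeff_def, simp add: Theta_def)
  ultimately have "Theta q = 0" by (simp add: Theta_of_real)
  then show False using Theta_pos[of q] q_pos q_less_1 by simp
qed

lemma qmoment_wave: "qmoment q \<gamma> n (\<lambda>x. of_real (wave s x)) = 0 \<longleftrightarrow> qint q \<gamma> (\<lambda>x. wave s x * x ^ n) = 0"
  using qint_of_real[OF wave_integrable, of s n] q_pos by (simp add: qmoment_def)

lemma not_determined_and_not_commutative:
  assumes "\<alpha> \<le> 1 / 2"
  shows "\<not> HS_moment_determined q \<gamma> \<alpha>" "\<not> HS_commutative q \<gamma> \<alpha>"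
proof -
  define f where "f = (\<lambda>x. complex_of_real (wave 0 x))"
  define g where "g = (\<lambda>x. complex_of_real (wave 1 x))"
  have f: "f \<in> HS_space q \<gamma> \<alpha>" and g: "g \<in> HS_space q \<gamma> \<alpha>"
    unfolding f_def g_def using assms by (auto intro: wave_in_HS)
  have mf: "qmoment q \<gamma> e f = 0" for e
    unfolding f_def qmoment_wave by (rule wave_moment_eq_0) simp
  \<comment> \<open>Every positive index is either 1, which is odd, or at least 2 = 2s.\<close>
  have mg: "qmoment q \<gamma> (Suc e) g = 0" for e
    unfolding g_def qmoment_wave by (rule wave_moment_eq_0) (cases e; auto)
  have mg0: "qmoment q \<gamma> 0 g \<noteq> 0"
    unfolding g_def qmoment_wave by (rule wave_1_integral)
  have zero: "(\<lambda>_. 0) \<in> HS_space q \<gamma> \<alpha>" using HS_cmult[OF f, of 0] by simp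
  obtain x where x: "x \<in> L" "f x \<noteq> 0" using wave_nonzero by (auto simp: f_def)
  show "\<not> HS_moment_determined q \<gamma> \<alpha>"
  proof
    assume "HS_moment_determined q \<gamma> \<alpha>"
    moreover have "qmoment q \<gamma> e (\<lambda>_. 0) = 0" for e by (simp add: qmoment_def qint_eq)
    ultimately have "eq_on_L q \<gamma> f (\<lambda>_. 0)"
      using f zero mf by (simp add: HS_moment_determined_def)
    then show False using x by (simp add: eq_on_L_def)
  qed
  \<comment> \<open>Each term carries a moment of the left factor. With \<open>f\<close> on the left
    all terms vanish; with \<open>g\<close> on the left only e = 0 remains, where no q-derivative is
    taken.\<close>
  have fg: "qconv_term q \<gamma> f g y = (\<lambda>_. 0)" for y
    by (simp add: fun_eq_iff qconv_term_def mf)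
  have gf: "qconv_term q \<gamma> g f y = (\<lambda>e. if e = 0 then qmoment q \<gamma> 0 g * f y else 0)" for y
  proof
    show "qconv_term q \<gamma> g f y e = (if e = 0 then qmoment q \<gamma> 0 g * f y else 0)" for e
      by (cases e) (simp_all add: qconv_term_def mg qfact_def)
  qed
  have sums: "qconv_term q \<gamma> g f y sums (qmoment q \<gamma> 0 g * f y)" for y
    unfolding gf using sums_single[of 0 "\<lambda>_. qmoment q \<gamma> 0 g * f y"] by simp
  have "(\<lambda>e. cmod (qconv_term q \<gamma> g f y e)) = (\<lambda>e. if e = 0 then cmod (qmoment q \<gamma> 0 g * f y) else 0)" for y
    unfolding gf by auto
  then have "summable (\<lambda>e. cmod (qconv_term q \<gamma> g f y e))" for y
    using sums_single[of 0 "\<lambda>_. cmod (qmoment q \<gamma> 0 g * f y)"] by (simp add: sums_iff)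
  then have "is_HS_product q \<gamma> \<alpha> g f (\<lambda>y. qmoment q \<gamma> 0 g * f y)"
    using HS_cmult[OF f] sums
    by (simp add: is_HS_product_def eq_on_L_def qconv_def qconv_converges_def sums_iff)
  moreover have "is_HS_product q \<gamma> \<alpha> f g (\<lambda>_. 0)"
    using zero by (simp add: is_HS_product_def eq_on_L_def qconv_def qconv_converges_def fg)
  moreover have "\<not> eq_on_L q \<gamma> (\<lambda>_. 0) (\<lambda>y. qmoment q \<gamma> 0 g * f y)"
    using x mg0 by (auto simp: eq_on_L_def)
  ultimately show "\<not> HS_commutative q \<gamma> \<alpha>"
    using f g unfolding HS_commutative_def by blast
qed

end

theorem mainTheorem4:
  fixes q \<gamma> \<alpha> :: real
  assumes "0 < q" and "q < 1" and "\<gamma> > 0" and "0 < \<alpha>" and "\<alpha> \<le> 1"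
  shows "HS_commutative q \<gamma> \<alpha> \<longleftrightarrow> HS_moment_determined q \<gamma> \<alpha>"
proof -
  interpret q_lattice q \<gamma> using assms by unfold_locales
  show ?thesis
  proof (cases "\<alpha> \<le> 1 / 2")
    case True
    then show ?thesis using not_determined_and_not_commutative by blast
  next
    case False
    then have "HS_moment_determined q \<gamma> \<alpha>" by (intro moment_determined_if_gt_half) simp
    then show ?thesis using commutative_if_moment_determined assms(4) by blast
  qed
qed

end
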